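(* Let $P(\lambda)=\ell(\lambda)\sum_{i=1}^{k+1}P_i\frac{w_i}{\gamma_i(\lambda)}$, $P_i\in\mathbb{C}^{m\times n}$, be a singular matrix polynomial expressed in the modified Lagrange basis associated with nodes $x_1,\ldots,x_{k+1}$. Let $0\le\mu\le k-1$ be an integer, $A\in\mathbb{C}^{(\mu+1)m\times(k-\mu-1)n}$, $B\in\mathbb{C}^{\mu m\times(k-\mu)n}$, and let $$L(\lambda)=\begin{bmatrix}M_\mu^L(\lambda)+AK_1^L(\lambda)+K_2^L(\lambda)^TB&K_2^L(\lambda)^T\\ K_1^L(\lambda)&0\end{bmatrix}.$$ Let $a_{\mu+1},\ldots,a_1$ be the $\mu$-2-coordinates of $1$ and $b_k,\ldots,b_{\mu+1}$ the $\mu$-1-coordinates of $1$. (a1) Suppose that $\{z_1(\lambda),\ldots,z_p(\lambda)\}$ is a minimal basis for the right nullspace of $L(\lambda)$, with the vector polynomials $z_i$ partitioned into blocks conformable with the blocks of $L(\lambda)$. Let $x_i(\lambda)=\begin{bmatrix}b_kI_n&\cdots&b_{\mu+1}I_n&0&\cdots&0\end{bmatrix}z_i(\lambda)$ for $i=1,\ldots,p$. Then $\{x_1(\lambda),\ldots,x_p(\lambda)\}$ is a minimal basis for the right nullspace of $P(\lambda)$. (a2) If $0\le\epsilon_1\le\cdots\le\epsilon_p$ are the right minimal indices of $L(\lambda)$, then $0\le\epsilon_1-k+\mu+1\le\cdots\le\epsilon_p-k+\mu+1$ are the right minimal indices of $P(\lambda)$. (b1) Suppose that $\{w_1(\lambda),\ldots,w_q(\lambda)\}$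 is a minimal basis for the left nullspace of $L(\lambda)$, with the vector polynomials $w_i$ partitioned into blocks conformable with the blocks of $L(\lambda)$. Let $y_i(\lambda)=\begin{bmatrix}a_{\mu+1}I_m&\cdots&a_1I_m&0&\cdots&0\end{bmatrix}w_i(\lambda)$ for $i=1,\ldots,q$. Then $\{y_1(\lambda),\ldots,y_q(\lambda)\}$ is a minimal basis for the left nullspace of $P(\lambda)$. (b2) If $0\le\mu_1\le\cdots\le\mu_q$ are the left minimal indices of $L(\lambda)$, then $0\le\mu_1-\mu\le\cdots\le\mu_q-\mu$ are the left minimal indices of $P(\lambda)$.
   Context: Lagrange setting. Let $k\ge1$, $m,n\ge1$, and let $x_1,\ldots,x_{k+1}\in\mathbb{C}$ be distinct nodes. Put $\gamma_i(\lambda)=\lambda-x_i$, $\ell(\lambda)=\prod_{i=1}^{k+1}(\lambda-x_i)$, $w_i=1/\prod_{j\ne i}(x_i-x_j)$ (scalars, not to be confused with the vector polynomials $w_i(\lambda)$), and $n_i^j(\lambda)=\prod_{t=i}^j\gamma_t(\lambda)$ if $j\ge i$, $n_i^j=1$ if $j<i$. For $0\le\mu\le k-1$, $$K_1^L(\lambda)=\begin{bmatrix}\gamma_{k+1}I_n&-\gamma_{k-1}I_n\\&\gamma_kI_n&-\gamma_{k-2}I_n\\&&\ddots&\ddots\\&&&\gamma_{\mu+3}I_n&-\gamma_{\mu+1}I_n\end{bmatrix},\quad K_2^L(\lambda)=\begin{bmatrix}\gamma_{\mu+2}I_m&-\gamma_{\mu}I_m\\&\gamma_{\mu+1}I_m&-\gamma_{\mu-1}I_m\\&&\ddots&\ddots\\&&&\gamma_3I_m&-\gamma_1I_m\end{bmatrix},$$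 of sizes $(k-\mu-1)n\times(k-\mu)n$ and $\mu m\times(\mu+1)m$ ($K_1^L$ is empty if $\mu=k-1$, $K_2^L$ is empty if $\mu=0$). $M_\mu^L(\lambda)$ is the $(\mu+1)\times(k-\mu)$ block pencil with $m\times n$ blocks: if $\mu<k-1$, its first block row is $[P_{k+1}w_{k+1}\gamma_k+P_kw_k\gamma_{k+1},\ P_{k-1}w_{k-1}\gamma_k,\ldots,P_{\mu+1}w_{\mu+1}\gamma_{\mu+2}]$, its last block column has, from top to bottom, blocks $P_{\mu+1}w_{\mu+1}\gamma_{\mu+2},P_\mu w_\mu\gamma_{\mu+1},\ldots,P_2w_2\gamma_3,P_1w_1\gamma_2$, and all other blocks are $0$; if $\mu=k-1$, it is the block column with blocks $P_{k+1}w_{k+1}\gamma_k+P_kw_k\gamma_{k+1},\ P_{k-1}w_{k-1}\gamma_k,\ldots,P_2w_2\gamma_3,P_1w_1\gamma_2$. Thus $L(\lambda)$ has $k-\mu$ block columns of width $n$ followed by $\mu$ of width $m$, and $\mu+1$ block rows of height $m$ followed by $k-\mu-1$ of height $n$. The $\mu$-2-coordinates of $1$ are the unique scalars $a_{\mu+1},\ldots,a_1$ with $\sum_{i=1}^{\mu+1}a_i\frac{n_1^{\mu+2}(\lambda)}{\gamma_{i+1}(\lambda)\gamma_i(\lambda)}=1$; the $\mu$-1-coordinates of $1$ are the unique scalars $b_k,\ldots,b_{\mu+1}$ with $\sum_{i=\mu+1}^kb_i\frac{n_{\mu+1}^{k+1}(\lambda)}{\gamma_{i+1}(\lambda)\gamma_i(\lambda)}=1$.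 A matrix polynomial $P(\lambda)$ of size $m\times n$ is singular if $m\ne n$ or $\det P(\lambda)\equiv0$. Its right and left nullspaces are $\mathcal{N}_r(P)=\{x\in\mathbb{C}(\lambda)^{n}:Px=0\}$ and $\mathcal{N}_\ell(P)=\{y\in\mathbb{C}(\lambda)^{m}:y^TP=0\}$. A minimal basis of a rational subspace is a basis consisting of vector polynomials whose sum of degrees is least among all polynomial bases of the subspace; the ordered degrees of its vectors are the minimal indices of the subspace; right (left) minimal indices of $P$ are those of $\mathcal{N}_r(P)$ ($\mathcal{N}_\ell(P)$). *)

theory Defs
  imports
    "Jordan_Normal_Form.Matrix_Kernel"
    "HOL-Computational_Algebra.Polynomial_Factorial"
begin

type_synonym poly_mat = "complex poly mat"
type_synonym poly_vec = "complex poly vec"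
type_synonym rat_vec = "complex poly fract vec"

section \<open>Nullspaces, minimal bases and minimal indices\<close>

text \<open>The field of rational functions is the fraction field of the polynomial ring.\<close>

definition singular_poly_mat :: "poly_mat \<Rightarrow> bool" where
  "singular_poly_mat P \<longleftrightarrow> dim_row P \<noteq> dim_col P \<or> det P = 0"

definition right_nullspace :: "poly_mat \<Rightarrow> rat_vec set" where
  "right_nullspace P = mat_kernel (map_mat to_fract P)"

text \<open>The condition that the row vector \<open>y\<^sup>T P\<close> vanishes is written as \<open>P\<^sup>T y = 0\<close>.\<close>

definition left_nullspace :: "poly_mat \<Rightarrow> rat_vec set" where
  "left_nullspace P = mat_kernel (transpose_mat (map_mat to_fract P))"

text \<open>A family of polynomial vectors is a list without repetitions; it is a basis of the
  subspace \<open>W\<close> of the rational \<open>d\<close>-vectors if its image over the rational functions is.\<close>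

definition poly_basis :: "nat \<Rightarrow> rat_vec set \<Rightarrow> poly_vec list \<Rightarrow> bool" where
  "poly_basis d W zs \<longleftrightarrow> distinct zs \<and>
     vectorspace.basis class_ring ((module_vec TYPE(complex poly fract) d)\<lparr>carrier := W\<rparr>)
       (map_vec to_fract ` set zs)"

text \<open>Only nonempty vectors matter here: a basis vector is nonzero.\<close>

definition vec_degree :: "poly_vec \<Rightarrow> nat" where
  "vec_degree v = (MAX i\<in>{..<dim_vec v}. degree (v $ i))"

definition minimal_basis :: "nat \<Rightarrow> rat_vec set \<Rightarrow> poly_vec list \<Rightarrow> bool" where
  "minimal_basis d W zs \<longleftrightarrow> poly_basis d W zs \<and>
     (\<forall>ys. poly_basis d W ys \<longrightarrow>
        sum_list (map vec_degree zs) \<le> sum_list (map vec_degree ys))"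

text \<open>The ordered degrees do not depend on the choice of the minimal basis, so this relation
  determines the list \<open>es\<close>.\<close>

definition minimal_indices :: "nat \<Rightarrow> rat_vec set \<Rightarrow> nat list \<Rightarrow> bool" where
  "minimal_indices d W es \<longleftrightarrow> (\<exists>zs. minimal_basis d W zs \<and> es = sort (map vec_degree zs))"

definition right_minimal_basis :: "poly_mat \<Rightarrow> poly_vec list \<Rightarrow> bool" where
  "right_minimal_basis P = minimal_basis (dim_col P) (right_nullspace P)"

definition left_minimal_basis :: "poly_mat \<Rightarrow> poly_vec list \<Rightarrow> bool" where
  "left_minimal_basis P = minimal_basis (dim_row P) (left_nullspace P)"

definition right_minimal_indices :: "poly_mat \<Rightarrow> nat list \<Rightarrow> bool" where
  "right_minimal_indices P = minimal_indices (dim_col P) (right_nullspace P)"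

definition left_minimal_indices :: "poly_mat \<Rightarrow> nat list \<Rightarrow> bool" where
  "left_minimal_indices P = minimal_indices (dim_row P) (left_nullspace P)"

section \<open>The modified Lagrange basis\<close>

text \<open>Nodes are \<open>x 1, \<dots>, x (k + 1)\<close>.\<close>

definition gam :: "(nat \<Rightarrow> complex) \<Rightarrow> nat \<Rightarrow> complex poly" where
  "gam x i = [:- x i, 1:]"

definition ell :: "(nat \<Rightarrow> complex) \<Rightarrow> nat \<Rightarrow> complex poly" where
  "ell x k = (\<Prod>i=1..k+1. gam x i)"

definition wt :: "(nat \<Rightarrow> complex) \<Rightarrow> nat \<Rightarrow> nat \<Rightarrow> complex" where
  "wt x k i = 1 / (\<Prod>j\<in>{1..k+1} - {i}. x i - x j)"

definition nprod :: "(nat \<Rightarrow> complex) \<Rightarrow> nat \<Rightarrow> nat \<Rightarrow> complex poly" where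
  "nprod x i j = (\<Prod>t=i..j. gam x t)"

text \<open>The polynomial divisions in the next definitions are exact.\<close>

lemma gam_dvd_ell: "i \<in> {1..k+1} \<Longrightarrow> gam x i dvd ell x k"
  unfolding ell_def by (rule dvd_prodI) auto

lemma gam_gam_dvd_nprod:
  assumes "p \<le> i" "i + 1 \<le> q"
  shows "gam x (i+1) * gam x i dvd nprod x p q"
proof -
  have "(\<Prod>t\<in>{i, i+1}. gam x t) dvd nprod x p q"
    unfolding nprod_def by (rule prod_dvd_prod_subset) (use assms in auto)
  moreover have "(\<Prod>t\<in>{i, i+1}. gam x t) = gam x (i+1) * gam x i"
    by (simp add: mult.commute)
  ultimately show ?thesis by metis
qed

definition lagrange_poly_mat ::
    "(nat \<Rightarrow> complex) \<Rightarrow> nat \<Rightarrow> nat \<Rightarrow> nat \<Rightarrow> (nat \<Rightarrow> complex mat) \<Rightarrow> poly_mat" where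
  "lagrange_poly_mat x k m n P =
     mat m n (\<lambda>(r,c). \<Sum>i=1..k+1. Polynomial.smult (P i $$ (r,c) * wt x k i) (ell x k div gam x i))"

text \<open>The \<open>\<mu>\<close>-2- and \<open>\<mu>\<close>-1-coordinates of a polynomial \<open>q\<close>; only the values of \<open>a\<close> on
  \<open>{1..\<mu>+1}\<close>, respectively of \<open>b\<close> on \<open>{\<mu>+1..k}\<close>, are relevant.\<close>

definition mu2_coords :: "(nat \<Rightarrow> complex) \<Rightarrow> nat \<Rightarrow> complex poly \<Rightarrow> (nat \<Rightarrow> complex) \<Rightarrow> bool" where
  "mu2_coords x \<mu> q a \<longleftrightarrow>
     (\<Sum>i=1..\<mu>+1. Polynomial.smult (a i) (nprod x 1 (\<mu>+2) div (gam x (i+1) * gam x i))) = q"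

definition mu1_coords ::
    "(nat \<Rightarrow> complex) \<Rightarrow> nat \<Rightarrow> nat \<Rightarrow> complex poly \<Rightarrow> (nat \<Rightarrow> complex) \<Rightarrow> bool" where
  "mu1_coords x k \<mu> q b \<longleftrightarrow>
     (\<Sum>i=\<mu>+1..k. Polynomial.smult (b i) (nprod x (\<mu>+1) (k+1) div (gam x (i+1) * gam x i))) = q"

section \<open>The block pencil\<close>

text \<open>\<open>block_mat R C p q F\<close> has \<open>R \<times> C\<close> blocks, the \<open>(r,c)\<close> block being the \<open>p \<times> q\<close> matrix
  \<open>F r c\<close>. Block indices start at \<open>0\<close>.\<close>

definition block_mat :: "nat \<Rightarrow> nat \<Rightarrow> nat \<Rightarrow> nat \<Rightarrow> (nat \<Rightarrow> nat \<Rightarrow> 'a mat) \<Rightarrow> 'a mat" where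
  "block_mat R C p q F =
     mat (R * p) (C * q) (\<lambda>(i,j). F (i div p) (j div q) $$ (i mod p, j mod q))"

definition const_poly_mat :: "complex mat \<Rightarrow> poly_mat" where
  "const_poly_mat A = map_mat (\<lambda>c. [:c:]) A"

text \<open>Block row \<open>r\<close> of the block bidiagonal pencil has \<open>\<gamma>\<^bsub>h-r\<^esub> I\<^sub>s\<close> on the diagonal and
  \<open>-\<gamma>\<^bsub>h-2-r\<^esub> I\<^sub>s\<close> to its right.\<close>

definition bidiag_pencil :: "(nat \<Rightarrow> complex) \<Rightarrow> nat \<Rightarrow> nat \<Rightarrow> nat \<Rightarrow> poly_mat" where
  "bidiag_pencil x h R s = block_mat R (R+1) s s
     (\<lambda>r c. if c = r then gam x (h - r) \<cdot>\<^sub>m 1\<^sub>m s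
            else if c = r + 1 then (- gam x (h - 2 - r)) \<cdot>\<^sub>m 1\<^sub>m s
            else 0\<^sub>m s s)"

definition K1_Lagr :: "(nat \<Rightarrow> complex) \<Rightarrow> nat \<Rightarrow> nat \<Rightarrow> nat \<Rightarrow> poly_mat" where
  "K1_Lagr x k \<mu> n = bidiag_pencil x (k+1) (k - \<mu> - 1) n"

definition K2_Lagr :: "(nat \<Rightarrow> complex) \<Rightarrow> nat \<Rightarrow> nat \<Rightarrow> poly_mat" where
  "K2_Lagr x \<mu> m = bidiag_pencil x (\<mu>+2) \<mu> m"

text \<open>Along the first block row (\<open>r = 0\<close>) and down the last block column (\<open>c = k - \<mu> - 1\<close>) the
  index of the coefficient drops by one at each step, so that it equals \<open>k - r - c\<close>. This also
  covers \<open>\<mu> = k - 1\<close>, where there is a single block column.\<close>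

definition M_Lagr ::
    "(nat \<Rightarrow> complex) \<Rightarrow> nat \<Rightarrow> nat \<Rightarrow> nat \<Rightarrow> nat \<Rightarrow> (nat \<Rightarrow> complex mat) \<Rightarrow> poly_mat" where
  "M_Lagr x k \<mu> m n P = block_mat (\<mu>+1) (k-\<mu>) m n
     (\<lambda>r c.
        if r = 0 \<and> c = 0 then
          Polynomial.smult (wt x k (k+1)) (gam x k) \<cdot>\<^sub>m const_poly_mat (P (k+1))
            + Polynomial.smult (wt x k k) (gam x (k+1)) \<cdot>\<^sub>m const_poly_mat (P k)
        else if r = 0 \<or> c = k - \<mu> - 1 then
          Polynomial.smult (wt x k (k-r-c)) (gam x (k-r-c+1)) \<cdot>\<^sub>m const_poly_mat (P (k-r-c))
        else 0\<^sub>m m n)"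

definition L_Lagr ::
    "(nat \<Rightarrow> complex) \<Rightarrow> nat \<Rightarrow> nat \<Rightarrow> nat \<Rightarrow> nat \<Rightarrow> (nat \<Rightarrow> complex mat) \<Rightarrow>
     complex mat \<Rightarrow> complex mat \<Rightarrow> poly_mat" where
  "L_Lagr x k \<mu> m n P A B =
     four_block_mat
       (M_Lagr x k \<mu> m n P + const_poly_mat A * K1_Lagr x k \<mu> n
          + transpose_mat (K2_Lagr x \<mu> m) * const_poly_mat B)
       (transpose_mat (K2_Lagr x \<mu> m))
       (K1_Lagr x k \<mu> n)
       (0\<^sub>m ((k-\<mu>-1) * n) (\<mu> * m))"

text \<open>The matrix \<open>[c\<^sub>h I\<^sub>s, c\<^bsub>h-1\<^esub> I\<^sub>s, \<dots>, 0]\<close> with \<open>t\<close> identity blocks followed by \<open>z\<close> zero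
  columns.\<close>

definition coord_row :: "nat \<Rightarrow> nat \<Rightarrow> nat \<Rightarrow> nat \<Rightarrow> (nat \<Rightarrow> complex) \<Rightarrow> poly_mat" where
  "coord_row s h t z c =
     four_block_mat (block_mat 1 t s s (\<lambda>_ j. [:c (h - j):] \<cdot>\<^sub>m 1\<^sub>m s)) (0\<^sub>m s z)
       (0\<^sub>m 0 (t * s)) (0\<^sub>m 0 z)"

definition right_recovery :: "nat \<Rightarrow> nat \<Rightarrow> nat \<Rightarrow> nat \<Rightarrow> (nat \<Rightarrow> complex) \<Rightarrow> poly_mat" where
  "right_recovery k \<mu> m n b = coord_row n k (k-\<mu>) (\<mu> * m) b"

definition left_recovery :: "nat \<Rightarrow> nat \<Rightarrow> nat \<Rightarrow> nat \<Rightarrow> (nat \<Rightarrow> complex) \<Rightarrow> poly_mat" where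
  "left_recovery k \<mu> m n a = coord_row m (\<mu>+1) (\<mu>+1) ((k-\<mu>-1) * n) a"

end

theory Submission
  imports Defs
begin

text \<open>Write \<open>N\<^sub>1\<close>, \<open>N\<^sub>2\<close> for the dual bases of \<open>K\<^sub>1\<close>, \<open>K\<^sub>2\<close>, so that \<open>K\<^sub>1 N\<^sub>1\<^sup>T = 0\<close> and \<open>N\<^sub>2 K\<^sub>2\<^sup>T = 0\<close>; the
  pencil satisfies \<open>N\<^sub>2 M N\<^sub>1\<^sup>T = P\<close>. A vector \<open>(u, v)\<close> lies in the kernel of \<open>L\<close> iff \<open>u = N\<^sub>1\<^sup>T p\<close> for some
  \<open>p\<close> and \<open>M u + K\<^sub>2\<^sup>T w = 0\<close> with \<open>w = B u + v\<close>; applying \<open>N\<^sub>2\<close> gives \<open>P p = 0\<close>, and the coordinates of \<open>1\<close>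
  recover \<open>p\<close> from \<open>u\<close>. Conversely, for a polynomial \<open>p\<close> in the kernel of \<open>P\<close> the equation for \<open>w\<close> has
  a unique polynomial solution, of degree at most that of \<open>u\<close>. Hence recovery is a bijection
  between the polynomial kernel vectors that lowers every degree by \<open>deg N\<^sub>1 = k - \<mu> - 1\<close>, and therefore
  preserves minimality. The left nullspace is the right nullspace of the transpose, and \<open>L\<^sup>T\<close> is a
  pencil of the same kind with the roles of \<open>K\<^sub>1\<close> and \<open>K\<^sub>2\<close> exchanged.\<close>

section \<open>Minimal bases under degree-shifting recovery maps\<close>

lemma (in vectorspace) fin_dim_basis: "basis A \<Longrightarrow> finite A \<Longrightarrow> fin_dim"
  unfolding basis_def fin_dim_def by blast

text \<open>Needed in \<open>poly_basis_lift\<close>, where bases travel backwards along the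
  recovery map: the inverse is again linear, so the same fact on images of bases serves both
  directions.\<close>

lemma (in linear_map) linear_map_inv:
  assumes inj: "inj_on T (carrier V)" and surj: "T ` carrier V = carrier W"
  shows "linear_map K W V (inv_into (carrier V) T)"
proof -
  let ?S = "inv_into (carrier V) T"
  have S: "?S w \<in> carrier V" "T (?S w) = w" if "w \<in> carrier W" for w
    using that surj by (auto intro: inv_into_into f_inv_into_f)
  have S_eqI: "?S w = v" if "v \<in> carrier V" "T v = w" for v w
    using that inj by (auto intro: inv_into_f_f)
  have "?S \<in> LinearCombinations.module_hom K W V"
    unfolding LinearCombinations.module_hom_def
    by (auto simp: S intro!: S_eqI)
  then show ?thesis
    by (intro linear_map.intro mod_hom.intro mod_hom_axioms.intro)
       (use V.vectorspace_axioms W.vectorspace_axioms vectorspace.axioms(1)[OF V.vectorspace_axioms]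
         vectorspace.axioms(1)[OF W.vectorspace_axioms] in auto)
qed

section \<open>Rational nullspaces and their polynomial bases\<close>

abbreviation null_vs :: "poly_mat \<Rightarrow> (complex poly fract, rat_vec) module" where
  "null_vs P \<equiv> (module_vec TYPE(complex poly fract) (dim_col P))\<lparr>carrier := right_nullspace P\<rparr>"

interpretation to_fract_hom: inj_comm_ring_hom "to_fract :: complex poly \<Rightarrow> complex poly fract"
  by unfold_locales auto

lemma vectorspace_null_vs: "vectorspace class_ring (null_vs P)"
proof -
  interpret kernel "dim_row P" "dim_col P" "map_mat to_fract P"
    by unfold_locales auto
  show ?thesis
    unfolding right_nullspace_def by (rule Ker.vectorspace_axioms)
qed

text \<open>As \<open>to_fract\<close> is an injective ring homomorphism, the kernel equation of a
  polynomial vector can be read over the polynomials, where the kernel computations below take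
  place.\<close>

lemma to_fract_mem_right_nullspace_iff:
  "map_vec to_fract z \<in> right_nullspace P \<longleftrightarrow>
     z \<in> carrier_vec (dim_col P) \<and> P *\<^sub>v z = 0\<^sub>v (dim_row P)"
proof (cases "z \<in> carrier_vec (dim_col P)")
  case True
  then show ?thesis
    unfolding right_nullspace_def mat_kernel_def
    by (auto simp: to_fract_hom.mult_mat_vec_hom[OF carrier_matI[OF refl refl] True, symmetric])
qed (auto simp: right_nullspace_def mat_kernel_def)

lemma mem_right_nullspace_iff:
  "v \<in> right_nullspace P \<longleftrightarrow>
     v \<in> carrier_vec (dim_col P) \<and> map_mat to_fract P *\<^sub>v v = 0\<^sub>v (dim_row P)"
  by (auto simp: right_nullspace_def mat_kernel_def)

lemma right_nullspace_carrier: "v \<in> right_nullspace P \<Longrightarrow> v \<in> carrier_vec (dim_col P)"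
  by (simp add: mem_right_nullspace_iff)

lemma null_vs_simps:
  "carrier (null_vs P) = right_nullspace P" "add (null_vs P) = (+)" "zero (null_vs P) = 0\<^sub>v (dim_col P)"
  "module.smult (null_vs P) = (\<cdot>\<^sub>v)"
  by (simp_all add: module_vec_def)

text \<open>Scale by the product of all denominators: each entry of \<open>?w\<close> is a numerator
  times the denominators of the other entries. Rational kernel vectors can thus be replaced by
  polynomial ones.\<close>

lemma clear_denominators:
  fixes v :: rat_vec
  assumes v: "v \<in> carrier_vec N"
  obtains q w where "q \<noteq> 0" "w \<in> carrier_vec N" "map_vec to_fract w = to_fract q \<cdot>\<^sub>v v"
proof -
  have "\<forall>i. \<exists>a b. v $ i = to_fract a / to_fract b \<and> b \<noteq> 0"
    by (metis Fract_cases Fract_conv_to_fract)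
  then obtain p r where pr: "\<And>i. v $ i = to_fract (p i) / to_fract (r i)" "\<And>i. r i \<noteq> 0"
    by metis
  let ?q = "\<Prod>i<N. r i"
  let ?w = "vec N (\<lambda>i. p i * prod r ({..<N} - {i}))"
  have "map_vec to_fract ?w = to_fract ?q \<cdot>\<^sub>v v"
  proof (rule eq_vecI)
    fix i assume "i < dim_vec (to_fract ?q \<cdot>\<^sub>v v)"
    with v have i: "i < N" by auto
    then have "?q = r i * prod r ({..<N} - {i})"
      by (subst prod.remove[of _ i]) auto
    then show "map_vec to_fract ?w $ i = (to_fract ?q \<cdot>\<^sub>v v) $ i"
      using i v pr by (simp add: field_simps)
  qed (use v in auto)
  with pr(2) show thesis
    by (intro that[of ?q ?w]) auto
qed

text \<open>Nonvanishing comes from linear independence; the degree shift under recovery is stated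
  for nonzero vectors.\<close>

lemma poly_basis_memD:
  assumes "poly_basis (dim_col P) (right_nullspace P) zs" "z \<in> set zs"
  shows "z \<noteq> 0\<^sub>v (dim_col P)" "z \<in> carrier_vec (dim_col P)" "P *\<^sub>v z = 0\<^sub>v (dim_row P)"
proof -
  interpret V: vectorspace class_ring "null_vs P" by (rule vectorspace_null_vs)
  from assms have B: "V.basis (map_vec to_fract ` set zs)"
    by (auto simp: poly_basis_def)
  then have mem: "map_vec to_fract z \<in> right_nullspace P"
    using assms(2) unfolding V.basis_def by auto
  then show "z \<in> carrier_vec (dim_col P)" "P *\<^sub>v z = 0\<^sub>v (dim_row P)"
    by (simp_all add: to_fract_mem_right_nullspace_iff)
  have nontriv: "(UNIV :: complex poly fract set) \<noteq> {0}"
    by (metis UNIV_I one_neq_zero singletonD)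
  have "\<zero>\<^bsub>null_vs P\<^esub> \<notin> map_vec to_fract ` set zs"
    using B V.zero_nin_lin_indpt[of "map_vec to_fract ` set zs"] nontriv
    unfolding V.basis_def by (simp add: class_ring_simps)
  then have "map_vec to_fract z \<noteq> (0\<^sub>v (dim_col P) :: rat_vec)"
    using assms(2) unfolding null_vs_simps by (metis imageI)
  then show "z \<noteq> 0\<^sub>v (dim_col P)"
    by simp
qed

text \<open>The length is the same for all bases, so a uniform shift of degrees moves all degree
  sums by one constant.\<close>

lemma poly_basis_length:
  assumes "poly_basis (dim_col P) (right_nullspace P) zs"
  shows "length zs = vectorspace.dim class_ring (null_vs P)"
proof -
  interpret V: vectorspace class_ring "null_vs P" by (rule vectorspace_null_vs)
  from assms have B: "V.basis (map_vec to_fract ` set zs)" "distinct zs"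
    by (auto simp: poly_basis_def)
  then have "V.dim = card (map_vec to_fract ` set zs)"
    by (intro V.dim_basis) auto
  also have "\<dots> = card (set zs)"
    by (rule card_image) (auto intro: inj_onI to_fract_hom.vec_hom_inj)
  finally show ?thesis
    using B(2) by (simp add: distinct_card)
qed

lemma sort_map_mono:
  assumes "mono f"
  shows "sort (map f xs) = map f (sort xs)"
proof (rule properties_for_sort)
  show "sorted (map f (sort xs))"
    by (rule sorted_map_mono) (use assms in \<open>auto intro: mono_onI dest: monoD\<close>)
qed simp

text \<open>The assumptions make \<open>R\<close> a bijection between the polynomial kernel vectors
  of \<open>L\<close> and \<open>Q\<close> that lowers degrees by \<open>d\<close>. Surjectivity is
  asked over the polynomials, so that polynomial bases lift to polynomial bases; the rational
  statements follow by clearing denominators.\<close>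

locale nullspace_recovery =
  fixes L Q R :: poly_mat and d :: nat
  assumes R: "R \<in> carrier_mat (dim_col Q) (dim_col L)"
    and recovers: "\<And>z. z \<in> carrier_vec (dim_col L) \<Longrightarrow> L *\<^sub>v z = 0\<^sub>v (dim_row L) \<Longrightarrow>
          Q *\<^sub>v (R *\<^sub>v z) = 0\<^sub>v (dim_row Q)"
    and inj: "\<And>z. z \<in> carrier_vec (dim_col L) \<Longrightarrow> L *\<^sub>v z = 0\<^sub>v (dim_row L) \<Longrightarrow>
          R *\<^sub>v z = 0\<^sub>v (dim_col Q) \<Longrightarrow> z = 0\<^sub>v (dim_col L)"
    and surj: "\<And>x. x \<in> carrier_vec (dim_col Q) \<Longrightarrow> Q *\<^sub>v x = 0\<^sub>v (dim_row Q) \<Longrightarrow>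
          \<exists>z \<in> carrier_vec (dim_col L). L *\<^sub>v z = 0\<^sub>v (dim_row L) \<and> R *\<^sub>v z = x"
    and deg: "\<And>z. z \<in> carrier_vec (dim_col L) \<Longrightarrow> L *\<^sub>v z = 0\<^sub>v (dim_row L) \<Longrightarrow>
          z \<noteq> 0\<^sub>v (dim_col L) \<Longrightarrow> vec_degree z = vec_degree (R *\<^sub>v z) + d"
begin

section \<open>The recovery map over the rational functions\<close>

definition T :: "rat_vec \<Rightarrow> rat_vec" where
  "T v = map_mat to_fract R *\<^sub>v v"

lemma T_to_fract:
  "z \<in> carrier_vec (dim_col L) \<Longrightarrow> T (map_vec to_fract z) = map_vec to_fract (R *\<^sub>v z)"
  unfolding T_def by (rule to_fract_hom.mult_mat_vec_hom[OF R, symmetric])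

lemma RF: "map_mat to_fract R \<in> carrier_mat (dim_col Q) (dim_col L)"
  using R by simp

lemma smult_mem:
  "v \<in> right_nullspace P \<Longrightarrow> c \<cdot>\<^sub>v v \<in> right_nullspace P"
  unfolding right_nullspace_def by (rule mat_kernel_smult[of _ "dim_row P" "dim_col P"]) auto

lemma smult_smult_inverse:
  fixes v :: rat_vec
  assumes "q \<noteq> 0"
  shows "inverse (to_fract q) \<cdot>\<^sub>v (to_fract q \<cdot>\<^sub>v v) = v"
  using assms by (simp add: smult_smult_assoc)

lemma T_smult: "v \<in> carrier_vec (dim_col L) \<Longrightarrow> T (c \<cdot>\<^sub>v v) = c \<cdot>\<^sub>v T v"
  unfolding T_def by (rule mult_mat_vec[OF RF])

lemma T_add: "v \<in> carrier_vec (dim_col L) \<Longrightarrow> w \<in> carrier_vec (dim_col L) \<Longrightarrow> T (v + w) = T v + T w"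
  unfolding T_def by (rule mult_add_distrib_mat_vec[OF RF])

text \<open>The route by which the assumptions on polynomial vectors reach \<open>T\<close>: apply
  them to \<open>w\<close>, then scale back by linearity.\<close>

lemma right_nullspace_scaled:
  assumes "v \<in> right_nullspace P"
  obtains q w where "q \<noteq> 0" "w \<in> carrier_vec (dim_col P)" "P *\<^sub>v w = 0\<^sub>v (dim_row P)"
    "v = inverse (to_fract q) \<cdot>\<^sub>v map_vec to_fract w"
proof -
  have "v \<in> carrier_vec (dim_col P)"
    using assms by (simp add: mem_right_nullspace_iff)
  then obtain q w where qw: "q \<noteq> 0" "w \<in> carrier_vec (dim_col P)"
    "map_vec to_fract w = to_fract q \<cdot>\<^sub>v v"
    by (rule clear_denominators)
  then have "map_vec to_fract w \<in> right_nullspace P"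
    using assms smult_mem by simp
  then have "P *\<^sub>v w = 0\<^sub>v (dim_row P)"
    unfolding to_fract_mem_right_nullspace_iff by blast
  with qw show thesis
    by (intro that[of q w]) (auto simp: smult_smult_inverse)
qed

lemma T_mem: "T v \<in> right_nullspace Q" if "v \<in> right_nullspace L"
proof -
  from that obtain q w where w: "q \<noteq> 0" "w \<in> carrier_vec (dim_col L)" "L *\<^sub>v w = 0\<^sub>v (dim_row L)"
    "v = inverse (to_fract q) \<cdot>\<^sub>v map_vec to_fract w"
    by (rule right_nullspace_scaled)
  have "map_vec to_fract (R *\<^sub>v w) \<in> right_nullspace Q"
    unfolding to_fract_mem_right_nullspace_iff using recovers[OF w(2,3)] R w(2) by auto
  then show ?thesis
    unfolding w(4) using w(2) by (simp add: T_smult T_to_fract smult_mem)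
qed

lemma T_eq_0: "v = 0\<^sub>v (dim_col L)" if "v \<in> right_nullspace L" "T v = 0\<^sub>v (dim_col Q)"
proof -
  from that(1) obtain q w where w: "q \<noteq> 0" "w \<in> carrier_vec (dim_col L)" "L *\<^sub>v w = 0\<^sub>v (dim_row L)"
    "v = inverse (to_fract q) \<cdot>\<^sub>v map_vec to_fract w"
    by (rule right_nullspace_scaled)
  have "T (to_fract q \<cdot>\<^sub>v v) = to_fract q \<cdot>\<^sub>v T v"
    using that by (intro T_smult) (auto simp: mem_right_nullspace_iff)
  moreover have "to_fract q \<cdot>\<^sub>v v = map_vec to_fract w"
    using w(1) by (simp add: w(4) smult_smult_assoc)
  moreover have "to_fract q \<cdot>\<^sub>v 0\<^sub>v (dim_col Q) = 0\<^sub>v (dim_col Q)"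
    by auto
  ultimately have "map_vec to_fract (R *\<^sub>v w) = 0\<^sub>v (dim_col Q)"
    using that(2) w(2) by (simp add: T_to_fract)
  then have "R *\<^sub>v w = 0\<^sub>v (dim_col Q)"
    by simp
  from inj[OF w(2,3) this] show ?thesis
    by (auto simp: w(4) to_fract_hom.vec_hom_zero)
qed

sublocale V: vectorspace class_ring "null_vs L" by (rule vectorspace_null_vs)
sublocale W: vectorspace class_ring "null_vs Q" by (rule vectorspace_null_vs)

sublocale T: linear_map class_ring "null_vs L" "null_vs Q" T
proof
  show "T \<in> LinearCombinations.module_hom class_ring (null_vs L) (null_vs Q)"
    unfolding LinearCombinations.module_hom_def
    by (simp add: T_mem Pi_iff null_vs_simps T_smult T_add right_nullspace_carrier)
qed

lemma inj_T: "inj_on T (right_nullspace L)"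
proof -
  have "carrier (null_vs L\<lparr>carrier := T.ker\<rparr>) = {zero (null_vs L)}"
  proof (intro equalityI subsetI)
    fix v assume "v \<in> carrier (null_vs L\<lparr>carrier := T.ker\<rparr>)"
    then have "v \<in> right_nullspace L" "T v = 0\<^sub>v (dim_col Q)"
      unfolding T.ker_def null_vs_simps by simp_all
    then show "v \<in> {zero (null_vs L)}"
      using T_eq_0 unfolding null_vs_simps by blast
  next
    fix v assume "v \<in> {zero (null_vs L)}"
    then show "v \<in> carrier (null_vs L\<lparr>carrier := T.ker\<rparr>)"
      using V.M.zero_closed T.f0_is_0 unfolding T.ker_def by simp
  qed
  from T.Ke0_imp_inj[OF this] show ?thesis
    unfolding null_vs_simps .
qed

lemma surj_T: "T ` right_nullspace L = right_nullspace Q"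
proof (intro equalityI subsetI)
  fix y assume "y \<in> right_nullspace Q"
  then obtain q x where x: "q \<noteq> 0" "x \<in> carrier_vec (dim_col Q)" "Q *\<^sub>v x = 0\<^sub>v (dim_row Q)"
    "y = inverse (to_fract q) \<cdot>\<^sub>v map_vec to_fract x"
    by (rule right_nullspace_scaled)
  from surj[OF x(2,3)] obtain z where z: "z \<in> carrier_vec (dim_col L)"
    "L *\<^sub>v z = 0\<^sub>v (dim_row L)" "R *\<^sub>v z = x" by blast
  have "y = T (inverse (to_fract q) \<cdot>\<^sub>v map_vec to_fract z)"
    using z by (simp add: x(4) T_smult T_to_fract)
  moreover have "inverse (to_fract q) \<cdot>\<^sub>v map_vec to_fract z \<in> right_nullspace L"
    using z by (intro smult_mem) (simp add: to_fract_mem_right_nullspace_iff)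
  ultimately show "y \<in> T ` right_nullspace L" by blast
qed (auto simp: T_mem)

lemma T_image_to_fract:
  assumes "set zs \<subseteq> carrier_vec (dim_col L)"
  shows "map_vec to_fract ` set (map (\<lambda>z. R *\<^sub>v z) zs) = T ` map_vec to_fract ` set zs"
  unfolding set_map image_image by (rule image_cong) (use assms T_to_fract in auto)

text \<open>\<open>T\<close> is a linear bijection of the nullspaces, so it maps bases to bases.
  Distinctness of the new list needs its own argument, from the injectivity of \<open>T\<close> and
  of \<open>to_fract\<close>.\<close>

lemma poly_basis_recovery:
  assumes "poly_basis (dim_col L) (right_nullspace L) zs"
  shows "poly_basis (dim_col Q) (right_nullspace Q) (map (\<lambda>z. R *\<^sub>v z) zs)"
proof -
  have B: "V.basis (map_vec to_fract ` set zs)" and dist: "distinct zs"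
    using assms unfolding poly_basis_def by (rule conjunct2, rule conjunct1)
  note zs = poly_basis_memD[OF assms]
  have fd: "V.fin_dim"
    using B by (rule V.fin_dim_basis) simp
  have "W.basis (T ` map_vec to_fract ` set zs)"
    by (rule T.linear_inj_image_is_basis[OF _ _ B fd]) (unfold null_vs_simps, rule inj_T, rule surj_T)
  moreover have "inj_on (\<lambda>z. R *\<^sub>v z) (set zs)"
  proof (rule inj_onI)
    fix y z assume yz: "y \<in> set zs" "z \<in> set zs" and "R *\<^sub>v y = R *\<^sub>v z"
    then have "T (map_vec to_fract y) = T (map_vec to_fract z)"
      using T_to_fract[OF zs(2)[OF yz(1)]] T_to_fract[OF zs(2)[OF yz(2)]] by (simp only:)
    moreover have "map_vec to_fract y \<in> right_nullspace L" "map_vec to_fract z \<in> right_nullspace L"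
      unfolding to_fract_mem_right_nullspace_iff using zs(2,3) yz by blast+
    ultimately have "map_vec to_fract y = (map_vec to_fract z :: rat_vec)"
      by (rule inj_onD[OF inj_T])
    then show "y = z" by (rule to_fract_hom.vec_hom_inj)
  qed
  moreover have "set zs \<subseteq> carrier_vec (dim_col L)"
    using zs(2) by blast
  ultimately show ?thesis
    unfolding poly_basis_def by (simp only: T_image_to_fract distinct_map dist simp_thms)
qed

text \<open>The inverse of \<open>T\<close> yields a basis of rational vectors only;
  \<open>surj\<close> provides polynomial preimages \<open>f y\<close>, and injectivity of
  \<open>T\<close> identifies the two.\<close>

lemma poly_basis_lift:
  assumes "poly_basis (dim_col Q) (right_nullspace Q) ys"
  obtains zs where "poly_basis (dim_col L) (right_nullspace L) zs" "map (\<lambda>z. R *\<^sub>v z) zs = ys"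
proof -
  note ys = poly_basis_memD[OF assms]
  have B: "W.basis (map_vec to_fract ` set ys)" and dist: "distinct ys"
    using assms unfolding poly_basis_def by (rule conjunct2, rule conjunct1)
  have "\<forall>y\<in>set ys. \<exists>z. z \<in> carrier_vec (dim_col L) \<and> L *\<^sub>v z = 0\<^sub>v (dim_row L) \<and> R *\<^sub>v z = y"
    using surj ys by blast
  then obtain f where f: "\<And>y. y \<in> set ys \<Longrightarrow> f y \<in> carrier_vec (dim_col L)"
    "\<And>y. y \<in> set ys \<Longrightarrow> L *\<^sub>v f y = 0\<^sub>v (dim_row L)" "\<And>y. y \<in> set ys \<Longrightarrow> R *\<^sub>v f y = y"
    by metis
  let ?S = "inv_into (right_nullspace L) T"
  interpret S: linear_map class_ring "null_vs Q" "null_vs L" ?S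
    using T.linear_map_inv unfolding null_vs_simps using inj_T surj_T by blast
  have fd: "W.fin_dim"
    using B by (rule W.fin_dim_basis) simp
  have "V.basis (?S ` map_vec to_fract ` set ys)"
  proof (rule S.linear_inj_image_is_basis[OF _ _ B fd])
    show "inj_on ?S (carrier (null_vs Q))"
      unfolding null_vs_simps by (rule inj_on_inv_into) (simp add: surj_T)
    show "?S ` carrier (null_vs Q) = carrier (null_vs L)"
      unfolding null_vs_simps by (subst surj_T[symmetric]) (rule inv_into_image_cancel[OF inj_T subset_refl])
  qed
  moreover have "?S (map_vec to_fract y) = map_vec to_fract (f y)" if "y \<in> set ys" for y
  proof (rule inv_into_f_eq[OF inj_T])
    show "map_vec to_fract (f y) \<in> right_nullspace L"
      using f that by (simp add: to_fract_mem_right_nullspace_iff)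
    show "T (map_vec to_fract (f y)) = map_vec to_fract y"
      using f that by (simp add: T_to_fract)
  qed
  then have "?S ` map_vec to_fract ` set ys = map_vec to_fract ` set (map f ys)"
    unfolding set_map image_image by (rule image_cong[OF refl])
  moreover have "inj_on f (set ys)"
    using f(3) by (rule inj_on_inverseI)
  ultimately have "poly_basis (dim_col L) (right_nullspace L) (map f ys)"
    unfolding poly_basis_def by (simp only: distinct_map dist simp_thms)
  moreover have "map (\<lambda>z. R *\<^sub>v z) (map f ys) = ys"
    using f(3) by (simp add: map_idI)
  ultimately show thesis by (rule that)
qed

lemma sum_degrees:
  assumes "poly_basis (dim_col L) (right_nullspace L) zs"
  shows "sum_list (map vec_degree zs) =
    sum_list (map vec_degree (map (\<lambda>z. R *\<^sub>v z) zs)) + V.dim * d"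
proof -
  note zs = poly_basis_memD[OF assms]
  have *: "map vec_degree zs = map (\<lambda>z. vec_degree (R *\<^sub>v z) + d) zs"
    using deg zs by simp
  show ?thesis
    unfolding * poly_basis_length[OF assms, symmetric] by (simp add: sum_list_addf comp_def sum_list_triv)
qed

text \<open>Any competitor \<open>ys\<close> lifts to a basis \<open>us\<close> for
  \<open>L\<close>. By \<open>sum_degrees\<close> both degree sums drop by the same constant
  \<open>V.dim * d\<close>, so the comparison for \<open>L\<close> carries over.\<close>

theorem right_minimal_basis_recovery:
  assumes "right_minimal_basis L zs"
  shows "right_minimal_basis Q (map (\<lambda>z. R *\<^sub>v z) zs)"
proof -
  from assms have B: "poly_basis (dim_col L) (right_nullspace L) zs"
    and least: "\<And>ys. poly_basis (dim_col L) (right_nullspace L) ys \<Longrightarrow>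
      sum_list (map vec_degree zs) \<le> sum_list (map vec_degree ys)"
    by (auto simp: right_minimal_basis_def minimal_basis_def)
  have "sum_list (map vec_degree (map (\<lambda>z. R *\<^sub>v z) zs)) \<le> sum_list (map vec_degree ys)"
    if ys: "poly_basis (dim_col Q) (right_nullspace Q) ys" for ys
  proof -
    from ys obtain us where us: "poly_basis (dim_col L) (right_nullspace L) us"
      "map (\<lambda>z. R *\<^sub>v z) us = ys"
      by (rule poly_basis_lift)
    show ?thesis
      using least[OF us(1)] unfolding sum_degrees[OF B] sum_degrees[OF us(1)] us(2) by simp
  qed
  then show ?thesis
    unfolding right_minimal_basis_def minimal_basis_def
    using poly_basis_recovery[OF B] by blast
qed

theorem right_minimal_indices_recovery:
  assumes "right_minimal_indices L es"
  shows "\<forall>e\<in>set es. d \<le> e" "right_minimal_indices Q (map (\<lambda>e. e - d) es)"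
proof -
  from assms obtain zs where zs: "right_minimal_basis L zs" and es: "es = sort (map vec_degree zs)"
    by (auto simp: right_minimal_indices_def minimal_indices_def right_minimal_basis_def)
  then have "poly_basis (dim_col L) (right_nullspace L) zs"
    by (simp add: right_minimal_basis_def minimal_basis_def)
  note B = poly_basis_memD[OF this]
  have degs: "\<And>z. z \<in> set zs \<Longrightarrow> vec_degree z = vec_degree (R *\<^sub>v z) + d"
    using deg B by blast
  then show "\<forall>e\<in>set es. d \<le> e"
    by (auto simp: es)
  \<comment> \<open>Truncated subtraction is monotone and so commutes with sorting; it undoes the
    shift exactly, since every degree is at least \<open>d\<close>.\<close>
  have "map (\<lambda>e. e - d) es = sort (map (\<lambda>e. e - d) (map vec_degree zs))"
    unfolding es by (rule sort_map_mono[symmetric]) (auto intro: monoI)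
  also have "map (\<lambda>e. e - d) (map vec_degree zs) = map vec_degree (map (\<lambda>z. R *\<^sub>v z) zs)"
    using degs by simp
  finally show "right_minimal_indices Q (map (\<lambda>e. e - d) es)"
    unfolding right_minimal_indices_def minimal_indices_def
    using right_minimal_basis_recovery[OF zs] unfolding right_minimal_basis_def by blast
qed

end

section \<open>The bidiagonal recurrence and its transpose\<close>

lemma degree_gam [simp]: "degree (gam x i) = 1"
  and gam_nonzero [simp]: "gam x i \<noteq> 0"
  by (simp_all add: gam_def)

lemma nprod_nonzero [simp]: "nprod x i j \<noteq> 0"
  by (simp add: nprod_def)

lemma degree_nprod: "degree (nprod x i j) = j + 1 - i"
  unfolding nprod_def by (subst degree_prod_eq_sum_degree) auto

lemma degree_gam_mult: "f \<noteq> 0 \<Longrightarrow> degree (gam x i * f) = degree f + 1"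
  by (simp add: degree_mult_eq)

text \<open>The entries of the dual basis of the scalar pencils \<open>K\<^sub>1\<close> and \<open>K\<^sub>2\<close>:
  they span the kernel of the bidiagonal recurrence.\<close>

definition nu :: "(nat \<Rightarrow> complex) \<Rightarrow> nat \<Rightarrow> nat \<Rightarrow> nat \<Rightarrow> complex poly" where
  "nu x lo hi i = nprod x lo hi div (gam x (i+1) * gam x i)"

context
  fixes x :: "nat \<Rightarrow> complex" and lo hi i :: nat
  assumes i: "lo \<le> i" "i < hi"
begin

lemma nu_mult: "nu x lo hi i * (gam x (i+1) * gam x i) = nprod x lo hi"
  unfolding nu_def using i by (intro dvd_div_mult_self gam_gam_dvd_nprod) auto

lemma nu_nonzero: "nu x lo hi i \<noteq> 0"
  using nu_mult by auto

lemma degree_nu: "degree (nu x lo hi i) = hi - lo - 1"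
proof -
  have "degree (nprod x lo hi) = degree (nu x lo hi i) + 2"
    unfolding nu_mult[symmetric] using nu_nonzero by (simp add: degree_mult_eq)
  then show ?thesis
    by (simp add: degree_nprod)
qed

lemma nu_Suc_hi: "nu x lo (Suc hi) i = gam x (Suc hi) * nu x lo hi i"
proof -
  have "nprod x lo (Suc hi) = gam x (Suc hi) * nu x lo hi i * (gam x (i+1) * gam x i)"
    using nu_mult i by (simp add: nprod_def mult.assoc)
  then show ?thesis
    unfolding nu_def[of x lo "Suc hi"] by simp
qed

end

text \<open>By \<open>nu_Suc_hi\<close> every lower entry keeps the factor
  \<open>gam x (Suc hi)\<close>; the top entry is the one that loses it. This contrast drives the
  elimination in \<open>transposed_recurrence_solvable\<close>.\<close>

lemma nu_top:
  assumes "1 \<le> lo" "lo \<le> hi"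
  shows "nu x lo (Suc hi) hi = nprod x lo (hi - 1)"
proof -
  from assms obtain h where hi: "hi = Suc h" by (cases hi) auto
  have "nprod x lo (Suc hi) = nprod x lo h * (gam x (hi+1) * gam x hi)"
    using assms by (simp add: nprod_def hi algebra_simps)
  then show ?thesis
    by (simp add: nu_def hi)
qed

text \<open>Both sides become \<open>nprod x lo hi\<close> after multiplication by
  \<open>gam x (Suc i)\<close>. This relation is one block row of the bidiagonal pencil applied to
  its dual basis.\<close>

lemma nu_step:
  assumes "lo \<le> i" "Suc i < hi"
  shows "gam x (i+2) * nu x lo hi (Suc i) = gam x i * nu x lo hi i"
proof -
  have "gam x (Suc i) * (gam x (i+2) * nu x lo hi (Suc i)) = gam x (Suc i) * (gam x i * nu x lo hi i)"
    using nu_mult[of lo i hi x] nu_mult[of lo "Suc i" hi x] assms by (simp add: algebra_simps)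
  then show ?thesis
    by simp
qed

text \<open>The recurrence determines all values from one, so \<open>f\<close> and \<open>nu\<close>
  are proportional over the rational functions; cross-multiplication keeps the statement inside the
  polynomials.\<close>

lemma recurrence_solution_proportional:
  assumes rec: "\<And>i. lo \<le> i \<Longrightarrow> Suc i < hi \<Longrightarrow> gam x (i+2) * f (Suc i) = gam x i * f i"
    and i: "lo \<le> i" "i < hi"
  shows "f i * nu x lo hi lo = f lo * nu x lo hi i"
  using i
proof (induction i rule: dec_induct)
  case (step i)
  \<comment> \<open>The extra factor is nonzero and is cancelled at the end; it lets both
    recurrences be used without division.\<close>
  have "(gam x (i+2) * gam x i * nu x lo hi i) * (f (Suc i) * nu x lo hi lo) =
      (gam x (i+2) * f (Suc i)) * (gam x i * nu x lo hi i) * nu x lo hi lo"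
    by (simp add: algebra_simps)
  also have "\<dots> = (gam x i * f i) * (gam x (i+2) * nu x lo hi (Suc i)) * nu x lo hi lo"
    using rec[of i] nu_step[of lo i hi x] step by simp
  also have "\<dots> = gam x i * (gam x (i+2) * nu x lo hi (Suc i)) * (f i * nu x lo hi lo)"
    by (simp add: algebra_simps)
  also have "f i * nu x lo hi lo = f lo * nu x lo hi i"
    using step by simp
  also have "gam x i * (gam x (i+2) * nu x lo hi (Suc i)) * (f lo * nu x lo hi i) =
      (gam x (i+2) * gam x i * nu x lo hi i) * (f lo * nu x lo hi (Suc i))"
    by (simp add: algebra_simps)
  finally show ?case
    using nu_nonzero[of lo i hi x] step by (simp only: mult_cancel_left mult_eq_0_iff) simp
qed simp

text \<open>If \<open>f\<close> is a multiple of \<open>nu\<close>, the coordinates of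
  \<open>1\<close> applied to \<open>f\<close> return the multiplier. In particular the multiplier
  is a polynomial.\<close>

lemma recurrence_solution:
  assumes rec: "\<And>i. lo \<le> i \<Longrightarrow> Suc i < hi \<Longrightarrow> gam x (i+2) * f (Suc i) = gam x i * f i"
    and c: "(\<Sum>j=lo..<hi. Polynomial.smult (c j) (nu x lo hi j)) = 1"
    and i: "lo \<le> i" "i < hi"
  shows "f i = nu x lo hi i * (\<Sum>j=lo..<hi. Polynomial.smult (c j) (f j))"
proof -
  have ratio: "f j * nu x lo hi lo = f lo * nu x lo hi j" if "lo \<le> j" "j < hi" for j
    using rec that by (rule recurrence_solution_proportional)
  let ?n = "nu x lo hi"
  have "?n lo * (?n i * (\<Sum>j=lo..<hi. Polynomial.smult (c j) (f j))) =
      ?n i * ((\<Sum>j=lo..<hi. Polynomial.smult (c j) (f j)) * ?n lo)"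
    by (simp add: algebra_simps)
  also have "(\<Sum>j=lo..<hi. Polynomial.smult (c j) (f j)) * ?n lo =
      (\<Sum>j=lo..<hi. Polynomial.smult (c j) (f j * ?n lo))"
    by (simp add: sum_distrib_right)
  also have "(\<Sum>j=lo..<hi. Polynomial.smult (c j) (f j * ?n lo)) =
      (\<Sum>j=lo..<hi. Polynomial.smult (c j) (f lo * ?n j))"
    by (intro sum.cong refl) (simp add: ratio)
  also have "\<dots> = f lo * (\<Sum>j=lo..<hi. Polynomial.smult (c j) (?n j))"
    by (simp add: sum_distrib_left)
  also have "\<dots> = f lo"
    by (simp add: c)
  finally have "?n lo * (?n i * (\<Sum>j=lo..<hi. Polynomial.smult (c j) (f j))) = ?n lo * f i"
    using ratio[OF i] by (simp add: mult.commute)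
  then show ?thesis
    using nu_nonzero[of lo lo hi x] i by simp
qed

text \<open>A linear factor divides a polynomial iff its node is a root, and \<open>nprod\<close>
  does not vanish at a node different from its own.\<close>

lemma gam_dvd_of_dvd_mult_nprod:
  assumes "gam x h dvd nprod x lo hi * y" "x h \<notin> x ` {lo..hi}"
  shows "gam x h dvd y"
proof -
  have "poly (nprod x lo hi) (x h) \<noteq> 0"
    using assms(2) by (auto simp: nprod_def poly_prod gam_def)
  moreover have "poly (nprod x lo hi * y) (x h) = 0"
    using assms(1) unfolding gam_def by (simp only: poly_eq_0_iff_dvd)
  ultimately show ?thesis
    by (simp add: gam_def poly_eq_0_iff_dvd[symmetric])
qed

text \<open>Solvability over the polynomials (not just over the rational functions) is where distinct
  nodes are needed: each \<open>\<gamma>\<^sub>h\<close> occurs in all summands of the relation but one, which it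
  divides by coprimality, so that the unknowns can be eliminated from the top.\<close>

lemma transposed_recurrence_solvable:
  assumes "1 \<le> lo" "lo < hi" "inj_on x {lo..hi}"
    and "(\<Sum>i=lo..<hi. nu x lo hi i * y i) = 0"
  shows "\<exists>f. f lo = 0 \<and> f hi = 0 \<and> (\<forall>i\<in>{lo..<hi}. gam x (i+1) * f i - gam x i * f (i+1) = y i)"
  using assms(2-)
proof (induction hi arbitrary: y rule: less_induct)
  case (less H)
  show ?case
  proof (cases "H = Suc lo")
    case True
    then have "y lo = 0"
      using less.prems(3) nu_nonzero[of lo lo H x] by simp
    then show ?thesis
      using True by (intro exI[of _ "\<lambda>_. 0"]) auto
  next
    case False
    with less.prems obtain h where H: "H = Suc (Suc h)" and h: "lo \<le> h"
      by (metis less_imp_Suc_add Suc_lessI less_Suc_eq_le add_Suc_right le_add1 not_less_eq)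
    let ?g = "gam x H" and ?n = "nprod x lo h"
    have top: "nu x lo H (Suc h) = ?n"
      using nu_top[of lo "Suc h" x] assms(1) h by (simp add: H)
    have low: "nu x lo H i = ?g * nu x lo (Suc h) i" if "lo \<le> i" "i < Suc h" for i
      using nu_Suc_hi[of lo i "Suc h" x] that by (simp add: H)
    \<comment> \<open>All summands except the top one share the factor \<open>?g\<close>, hence
      \<open>?g\<close> divides the top summand as well.\<close>
    have sum0: "?g * (\<Sum>i=lo..<Suc h. nu x lo (Suc h) i * y i) + ?n * y (Suc h) = 0"
    proof -
      have "(\<Sum>i=lo..<H. nu x lo H i * y i) =
          (\<Sum>i=lo..<Suc h. nu x lo H i * y i) + ?n * y (Suc h)"
        using h by (simp add: H top[unfolded H])
      also have "(\<Sum>i=lo..<Suc h. nu x lo H i * y i) =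
          ?g * (\<Sum>i=lo..<Suc h. nu x lo (Suc h) i * y i)"
        unfolding sum_distrib_left by (intro sum.cong refl) (simp add: low algebra_simps)
      finally show ?thesis
        using less.prems(3) by simp
    qed
    then have "?g dvd ?n * y (Suc h)"
      by (metis dvd_add_right_iff dvd_triv_left dvd_0_right)
    then have "?g dvd y (Suc h)"
      by (rule gam_dvd_of_dvd_mult_nprod) (use less.prems(2) h in \<open>force simp: H inj_on_def\<close>)
    then obtain q where q: "y (Suc h) = ?g * q" ..
    \<comment> \<open>With \<open>f H = 0\<close> the top equation forces
      \<open>f (Suc h) = q\<close>. Moving the resulting term \<open>gam x h * q\<close> of equation
      \<open>h\<close> to the right-hand side leaves the same problem with upper end
      \<open>Suc h\<close> and boundary value zero there.\<close>
    let ?y = "y(h := y h + gam x h * q)"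
    have nu_h: "nu x lo (Suc h) h * gam x h = ?n"
    proof -
      have "(nu x lo (Suc h) h * gam x h) * gam x (Suc h) = ?n * gam x (Suc h)"
        using nu_mult[of lo h "Suc h" x] h by (simp add: nprod_def algebra_simps)
      then show ?thesis
        by simp
    qed
    have "?g * (\<Sum>i=lo..<Suc h. nu x lo (Suc h) i * ?y i) = 0"
    proof -
      have "(\<Sum>i=lo..<Suc h. nu x lo (Suc h) i * ?y i) =
          (\<Sum>i=lo..<Suc h. nu x lo (Suc h) i * y i) + ?n * q"
        using h nu_h[symmetric] by (simp add: algebra_simps)
      then show ?thesis
        using sum0 q by (simp add: algebra_simps)
    qed
    then have "(\<Sum>i=lo..<Suc h. nu x lo (Suc h) i * ?y i) = 0"
      by simp
    moreover have "inj_on x {lo..Suc h}"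
      using less.prems(2) by (rule inj_on_subset) (auto simp: H)
    ultimately obtain f where f: "f lo = 0" "f (Suc h) = 0"
      "\<forall>i\<in>{lo..<Suc h}. gam x (i+1) * f i - gam x i * f (i+1) = ?y i"
      using less.IH[of "Suc h" ?y] h by (auto simp: H)
    show ?thesis
    proof (intro exI[of _ "f(Suc h := q, H := 0)"] conjI ballI)
      fix i assume "i \<in> {lo..<H}"
      then consider "i = Suc h" | "i = h" | "lo \<le> i" "i < h"
        using H by force
      then show "gam x (i+1) * (f(Suc h := q, H := 0)) i - gam x i * (f(Suc h := q, H := 0)) (i+1) = y i"
        using f h q by cases (force simp: H)+
    qed (use f h in \<open>auto simp: H\<close>)
  qed
qed

text \<open>The sum telescopes by \<open>nu_step\<close>, and the zero boundary values remove both
  ends.\<close>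

lemma transposed_recurrence_annihilated:
  assumes "lo < hi" "f lo = 0" "f hi = 0"
  shows "(\<Sum>i=lo..<hi. nu x lo hi i * (gam x (i+1) * f i - gam x i * f (i+1))) = 0"
proof -
  \<comment> \<open>Closed form of the partial sums; at \<open>j = hi - 1\<close> the remaining term
    contains \<open>f hi = 0\<close>.\<close>
  have "(\<Sum>i=lo..<Suc j. nu x lo hi i * (gam x (i+1) * f i - gam x i * f (i+1))) =
      - (nu x lo hi j * gam x j * f (Suc j))" if "lo \<le> j" "j < hi" for j
    using that
  proof (induction j rule: dec_induct)
    case (step j)
    have "nu x lo hi (Suc j) * gam x (j+2) = nu x lo hi j * gam x j"
      using nu_step[of lo j hi x] step by (simp add: mult.commute)
    with step show ?case
      by (simp add: algebra_simps)
  qed (use assms in simp)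
  from this[of "hi - 1"] show ?thesis
    using assms by simp
qed

text \<open>Downward induction from \<open>f hi = 0\<close>: \<open>gam x (i+1) * f i\<close> has
  degree at most \<open>D + 1\<close>, and dividing by the linear factor brings the bound back to
  \<open>D\<close>, so degrees do not accumulate.\<close>

lemma transposed_recurrence_degree:
  assumes "f hi = 0"
    and "\<And>i. lo \<le> i \<Longrightarrow> i < hi \<Longrightarrow> gam x (i+1) * f i - gam x i * f (i+1) = y i"
    and "\<And>i. lo \<le> i \<Longrightarrow> i < hi \<Longrightarrow> degree (y i) \<le> D + 1"
    and "lo \<le> i" "i \<le> hi"
  shows "degree (f i) \<le> D"
  using assms(5,4)
proof (induction i rule: inc_induct)
  case (step i)
  then have i: "lo \<le> i" "i < hi" and IH: "degree (f (Suc i)) \<le> D" by auto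
  have "gam x (i+1) * f i = y i + gam x i * f (i+1)"
    using assms(2)[OF i] by (simp add: algebra_simps)
  moreover have "degree (y i + gam x i * f (i+1)) \<le> D + 1"
    using assms(3)[OF i] degree_mult_le[of "gam x i" "f (i+1)"] IH by (intro degree_add_le) auto
  ultimately have "degree (gam x (i+1) * f i) \<le> D + 1"
    by simp
  then show ?case
    by (cases "f i = 0") (simp_all add: degree_gam_mult)
qed (use assms(1) in simp)

lemma transposed_recurrence_unique:
  assumes "f hi = 0"
    and "\<And>i. lo \<le> i \<Longrightarrow> i < hi \<Longrightarrow> gam x (i+1) * f i - gam x i * f (i+1) = 0"
    and "lo \<le> i" "i \<le> hi"
  shows "f i = 0"
  using assms(4,3)
proof (induction i rule: inc_induct)
  case (step i)
  then show ?case
    using assms(2)[of i] by simp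
qed (use assms(1) in simp)

section \<open>Block matrices and block vectors\<close>

lemma block_index_less: "r < R \<Longrightarrow> c < p \<Longrightarrow> r * p + c < R * (p::nat)"
proof -
  assume "r < R" "c < p"
  then have "r * p + c < Suc r * p" by simp
  also have "\<dots> \<le> R * p" using \<open>r < R\<close> by (intro mult_le_mono1) simp
  finally show ?thesis .
qed

lemma sum_blocks: "(\<Sum>i<C * q. f i) = (\<Sum>j<C. \<Sum>l<q. f (j * q + l :: nat))"
proof -
  have "(\<Sum>i<C * q. f i) = (\<Sum>j<C. sum f {j * q..<j * q + q})"
    by (rule sum.nat_group[symmetric])
  also have "\<dots> = (\<Sum>j<C. \<Sum>l<q. f (j * q + l))"
    by (rule sum.cong[OF refl]) (simp add: sum.atLeastLessThan_shift_0[of f] lessThan_atLeast0)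
  finally show ?thesis .
qed

lemma eq_vec_blocksI:
  assumes "v \<in> carrier_vec (R * s)" "w \<in> carrier_vec (R * s)"
    and "\<And>r c. r < R \<Longrightarrow> c < s \<Longrightarrow> v $ (r * s + c) = w $ (r * s + c)"
  shows "v = w"
proof (rule eq_vecI)
  fix i assume "i < dim_vec w"
  with assms have i: "i < R * s" by auto
  then have "s > 0" by (cases s) auto
  with i have "i div s < R" "i mod s < s"
    by (simp_all add: less_mult_imp_div_less)
  from assms(3)[OF this] show "v $ i = w $ i" by simp
qed (use assms in auto)

lemma mult_mat_vec_blocks:
  assumes "M \<in> carrier_mat d (C * q)" "v \<in> carrier_vec (C * q)" "i < d"
  shows "(M *\<^sub>v v) $ i = (\<Sum>j<C. \<Sum>l<q. M $$ (i, j * q + l) * v $ (j * q + l))"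
proof -
  have "(M *\<^sub>v v) $ i = (\<Sum>l<C * q. M $$ (i, l) * v $ l)"
    using assms by (simp add: scalar_prod_def lessThan_atLeast0)
  then show ?thesis
    by (simp add: sum_blocks)
qed

lemma block_mat_carrier [simp]: "block_mat R C p q F \<in> carrier_mat (R * p) (C * q)"
  by (simp add: block_mat_def)

lemma block_mat_index:
  assumes "r < R" "c < p" "j < C" "l < q"
  shows "block_mat R C p q F $$ (r * p + c, j * q + l) = F r j $$ (c, l)"
  using assms block_index_less[of r R c p] block_index_less[of j C l q]
  by (simp add: block_mat_def)

lemma bidiag_pencil_carrier: "bidiag_pencil x h R s \<in> carrier_mat (R * s) (Suc R * s)"
  unfolding bidiag_pencil_def Suc_eq_plus1 by (rule block_mat_carrier)

lemma bidiag_pencil_index: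
  assumes "r < R" "c < s" "j \<le> R" "l < s"
  shows "bidiag_pencil x h R s $$ (r * s + c, j * s + l) =
    (if l = c then if j = r then gam x (h - r) else if j = Suc r then - gam x (h - 2 - r) else 0 else 0)"
  using assms by (auto simp: bidiag_pencil_def block_mat_index)

lemma bidiag_pencil_mult_vec:
  assumes "v \<in> carrier_vec (Suc R * s)" "r < R" "c < s"
  shows "(bidiag_pencil x h R s *\<^sub>v v) $ (r * s + c) =
    gam x (h - r) * v $ (r * s + c) - gam x (h - 2 - r) * v $ (Suc r * s + c)"
proof -
  have "(bidiag_pencil x h R s *\<^sub>v v) $ (r * s + c) =
      (\<Sum>j<Suc R. \<Sum>l<s. bidiag_pencil x h R s $$ (r * s + c, j * s + l) * v $ (j * s + l))"
    using assms by (intro mult_mat_vec_blocks[OF bidiag_pencil_carrier] block_index_less)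
  also have "\<dots> = (\<Sum>j<Suc R. \<Sum>l<s. if l = c then
      (if j = r then gam x (h - r) else if j = Suc r then - gam x (h - 2 - r) else 0) * v $ (j * s + c) else 0)"
    using assms by (intro sum.cong refl) (auto simp: bidiag_pencil_index)
  also have "\<dots> = (\<Sum>j<Suc R. (if j = r then gam x (h - r) * v $ (r * s + c) else 0) +
      (if j = Suc r then - gam x (h - 2 - r) * v $ (Suc r * s + c) else 0))"
    using assms(3) by (intro sum.cong refl) auto
  also have "\<dots> = gam x (h - r) * v $ (r * s + c) - gam x (h - 2 - r) * v $ (Suc r * s + c)"
    using assms(2) by (simp add: sum.distrib del: sum.lessThan_Suc)
  finally show ?thesis .
qed

text \<open>Block column \<open>r\<close> of the pencil meets the diagonal in block row
  \<open>r\<close> and the superdiagonal in block row \<open>r - 1\<close>; the two conditionals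
  cover the last and the first block column, where one of these is missing.\<close>

lemma transpose_bidiag_pencil_mult_vec:
  assumes "v \<in> carrier_vec (R * s)" "r \<le> R" "c < s"
  shows "((bidiag_pencil x h R s)\<^sup>T *\<^sub>v v) $ (r * s + c) =
    (if r < R then gam x (h - r) * v $ (r * s + c) else 0)
    - (if 0 < r then gam x (h - 1 - r) * v $ ((r - 1) * s + c) else 0)"
proof -
  have T: "(bidiag_pencil x h R s)\<^sup>T \<in> carrier_mat (Suc R * s) (R * s)"
    using bidiag_pencil_carrier by simp
  have "((bidiag_pencil x h R s)\<^sup>T *\<^sub>v v) $ (r * s + c) =
      (\<Sum>j<R. \<Sum>l<s. (bidiag_pencil x h R s)\<^sup>T $$ (r * s + c, j * s + l) * v $ (j * s + l))"
    using assms by (intro mult_mat_vec_blocks[OF T] block_index_less) auto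
  also have "\<dots> = (\<Sum>j<R. \<Sum>l<s. if l = c then
      (if r = j then gam x (h - j) else if r = Suc j then - gam x (h - 2 - j) else 0) * v $ (j * s + c) else 0)"
  proof (intro sum.cong refl)
    fix j l assume "j \<in> {..<R}" "l \<in> {..<s}"
    moreover from this assms have "(bidiag_pencil x h R s)\<^sup>T $$ (r * s + c, j * s + l) =
        bidiag_pencil x h R s $$ (j * s + l, r * s + c)"
      using bidiag_pencil_carrier[of x h R s] block_index_less[of r "Suc R" c s] block_index_less[of j R l s]
      by (intro index_transpose_mat) auto
    ultimately show "(bidiag_pencil x h R s)\<^sup>T $$ (r * s + c, j * s + l) * v $ (j * s + l) =
        (if l = c then
      (if r = j then gam x (h - j) else if r = Suc j then - gam x (h - 2 - j) else 0) * v $ (j * s + c) else 0)"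
      using assms by (auto simp: bidiag_pencil_index)
  qed
  also have "\<dots> = (\<Sum>j<R. (if j = r then gam x (h - r) * v $ (r * s + c) else 0) +
      (if j = r - 1 then if 0 < r then - gam x (h - 1 - r) * v $ ((r - 1) * s + c) else 0 else 0))"
    using assms(3) by (intro sum.cong refl) auto
  also have "\<dots> = (if r < R then gam x (h - r) * v $ (r * s + c) else 0)
    - (if 0 < r then gam x (h - 1 - r) * v $ ((r - 1) * s + c) else 0)"
    using assms(2) by (auto simp: sum.distrib)
  finally show ?thesis .
qed

lemma coord_row_carrier: "coord_row s h t z c \<in> carrier_mat s (t * s + z)"
proof -
  have "coord_row s h t z c \<in> carrier_mat (1 * s + 0) (t * s + z)"
    unfolding coord_row_def by (intro four_block_carrier_mat block_mat_carrier) auto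
  then show ?thesis
    by simp
qed

lemma coord_row_mult_vec:
  assumes u: "u \<in> carrier_vec (t * s)" and v: "v \<in> carrier_vec z" and i: "i < s"
  shows "(coord_row s h t z c *\<^sub>v (u @\<^sub>v v)) $ i = (\<Sum>j<t. Polynomial.smult (c (h - j)) (u $ (j * s + i)))"
proof -
  let ?B = "block_mat 1 t s s (\<lambda>_ j. [:c (h - j):] \<cdot>\<^sub>m 1\<^sub>m s)"
  have B: "?B \<in> carrier_mat s (t * s)"
    using block_mat_carrier[of 1 t s s] by simp
  have "coord_row s h t z c *\<^sub>v (u @\<^sub>v v) =
      (?B *\<^sub>v u + 0\<^sub>m s z *\<^sub>v v) @\<^sub>v (0\<^sub>m 0 (t * s) *\<^sub>v u + 0\<^sub>m 0 z *\<^sub>v v)"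
    unfolding coord_row_def by (rule four_block_mat_mult_vec[OF B _ _ _ u v]) auto
  moreover have "0\<^sub>m s z *\<^sub>v v = 0\<^sub>v s"
    using v by auto
  ultimately have "(coord_row s h t z c *\<^sub>v (u @\<^sub>v v)) $ i = (?B *\<^sub>v u) $ i"
    using i B u by auto
  also have "\<dots> = (\<Sum>j<t. \<Sum>l<s. ?B $$ (i, j * s + l) * u $ (j * s + l))"
    by (rule mult_mat_vec_blocks[OF B u i])
  also have "\<dots> = (\<Sum>j<t. \<Sum>l<s. if l = i then [:c (h - j):] * u $ (j * s + i) else 0)"
  proof (intro sum.cong refl)
    fix j l assume "j \<in> {..<t}" "l \<in> {..<s}"
    then show "?B $$ (i, j * s + l) * u $ (j * s + l) = (if l = i then [:c (h - j):] * u $ (j * s + i) else 0)"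
      using block_mat_index[of 0 1 i s j t l s "\<lambda>_ j. [:c (h - j):] \<cdot>\<^sub>m 1\<^sub>m s"] i by auto
  qed
  also have "\<dots> = (\<Sum>j<t. Polynomial.smult (c (h - j)) (u $ (j * s + i)))"
    using i by simp
  finally show ?thesis .
qed

section \<open>Degrees of polynomial vectors\<close>

lemma vec_degree_le_iff:
  assumes "dim_vec v > 0"
  shows "vec_degree v \<le> D \<longleftrightarrow> (\<forall>i<dim_vec v. degree (v $ i) \<le> D)"
  unfolding vec_degree_def using assms by (subst Max_le_iff) auto

lemma degree_le_vec_degree: "i < dim_vec v \<Longrightarrow> degree (v $ i) \<le> vec_degree v"
  unfolding vec_degree_def by (rule Max_ge) auto

lemma vec_degree_attained:
  assumes "v \<in> carrier_vec d" "v \<noteq> 0\<^sub>v d"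
  obtains i where "i < d" "v $ i \<noteq> 0" "degree (v $ i) = vec_degree v"
proof -
  from assms obtain j where j: "j < d" "v $ j \<noteq> 0"
    by (metis carrier_vecD eq_vecI index_zero_vec)
  let ?D = "(\<lambda>i. degree (v $ i)) ` {..<d}"
  have "Max ?D \<in> ?D"
    using j(1) by (intro Max_in) auto
  then obtain i where i: "i < d" "degree (v $ i) = vec_degree v"
    using assms(1) by (auto simp: vec_degree_def)
  show thesis
  proof (cases "v $ i = 0")
    \<comment> \<open>If the maximal degree sits at a zero entry, it is \<open>0\<close>, so every
      entry has it, in particular the nonzero entry \<open>j\<close>.\<close>
    case True
    have "degree (v $ j) = vec_degree v"
      using degree_le_vec_degree[of j v] i(2) j(1) assms(1) True by simp
    with that j show ?thesis by blast
  qed (use that i in blast)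
qed

text \<open>Block \<open>r\<close> of the pencil belongs to the node index \<open>lo + t - r\<close>, since the paper numbers the
  blocks downwards.\<close>

definition nub :: "(nat \<Rightarrow> complex) \<Rightarrow> nat \<Rightarrow> nat \<Rightarrow> nat \<Rightarrow> complex poly" where
  "nub x lo t r = nu x lo (Suc (lo + t)) (lo + t - r)"

text \<open>This is \<open>N\<^sup>T v\<close> for the dual basis \<open>N\<close> of the pencil,
  whose blocks are \<open>nub x lo t r\<close> times the identity.\<close>

definition dual_lift :: "(nat \<Rightarrow> complex) \<Rightarrow> nat \<Rightarrow> nat \<Rightarrow> nat \<Rightarrow> poly_vec \<Rightarrow> poly_vec" where
  "dual_lift x lo t s v = vec (Suc t * s) (\<lambda>i. nub x lo t (i div s) * v $ (i mod s))"

text \<open>One family for both pencils: \<open>K\<^sub>1\<close> is the case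
  \<open>lo = Suc \<mu>\<close> and \<open>K\<^sub>2\<close> the case \<open>lo = 1\<close>, with
  \<open>t\<close> block rows.\<close>

abbreviation bidiag :: "(nat \<Rightarrow> complex) \<Rightarrow> nat \<Rightarrow> nat \<Rightarrow> nat \<Rightarrow> poly_mat" where
  "bidiag x lo t s \<equiv> bidiag_pencil x (Suc (lo + t)) t s"

text \<open>Passes between node indices and block indices, which run in opposite directions;
  \<open>g\<close> receives both so that a summand may mention either.\<close>

lemma sum_reversed_block_index:
  "(\<Sum>i=lo..<Suc (lo + t). g i (lo + t - i)) = (\<Sum>r<Suc t. g (lo + t - r) (r :: nat))"
  by (rule sum.reindex_bij_witness[of _ "\<lambda>r. lo + t - r" "\<lambda>i. lo + t - i"]) auto

lemma dual_lift_carrier [simp]: "dual_lift x lo t s v \<in> carrier_vec (Suc t * s)"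
  by (simp add: dual_lift_def)

lemma dual_lift_index:
  assumes "r \<le> t" "c < s"
  shows "dual_lift x lo t s v $ (r * s + c) = nub x lo t r * v $ c"
  using assms block_index_less[of r "Suc t" c s] by (simp add: dual_lift_def)

lemma nub_nonzero: "r \<le> t \<Longrightarrow> nub x lo t r \<noteq> 0"
  and degree_nub: "r \<le> t \<Longrightarrow> degree (nub x lo t r) = t"
  unfolding nub_def by (subst nu_nonzero degree_nu; simp)+

lemma bidiag_dual_lift:
  "bidiag x lo t s *\<^sub>v dual_lift x lo t s v = 0\<^sub>v (t * s)"
proof (rule eq_vec_blocksI)
  fix r c assume rc: "r < t" "c < s"
  \<comment> \<open>Block row \<open>r\<close> couples the blocks \<open>r\<close> and
    \<open>Suc r\<close>, which belong to the node indices \<open>i + 1\<close> and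
    \<open>i\<close>.\<close>
  define i where "i = lo + t - Suc r"
  have i: "lo + t - r = Suc i" "Suc (lo + t) - r = i + 2" "Suc (lo + t) - 2 - r = i" "lo \<le> i"
    using rc by (auto simp: i_def)
  have "(bidiag x lo t s *\<^sub>v dual_lift x lo t s v) $ (r * s + c) =
      gam x (i + 2) * (nub x lo t r * v $ c) - gam x i * (nub x lo t (Suc r) * v $ c)"
    using rc by (subst bidiag_pencil_mult_vec) (simp_all only: dual_lift_carrier dual_lift_index i less_imp_le Suc_leI)
  also have "\<dots> = (gam x (i + 2) * nu x lo (Suc (lo + t)) (Suc i) - gam x i * nu x lo (Suc (lo + t)) i) * v $ c"
    using i by (simp add: nub_def i_def[symmetric] algebra_simps)
  also have "\<dots> = 0"
    using i by (subst nu_step) auto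
  finally show "(bidiag x lo t s *\<^sub>v dual_lift x lo t s v) $ (r * s + c) = 0\<^sub>v (t * s) $ (r * s + c)"
    using block_index_less[OF rc] by simp
qed (rule mult_mat_vec_carrier[OF bidiag_pencil_carrier dual_lift_carrier], simp)

definition coords_of_one :: "(nat \<Rightarrow> complex) \<Rightarrow> nat \<Rightarrow> nat \<Rightarrow> (nat \<Rightarrow> complex) \<Rightarrow> bool" where
  "coords_of_one x lo t a \<longleftrightarrow> (\<Sum>r<Suc t. Polynomial.smult (a (lo + t - r)) (nub x lo t r)) = 1"

text \<open>At each position \<open>c\<close> inside the blocks, the entries ordered by node index
  satisfy the scalar recurrence, so \<open>recurrence_solution\<close> applies; the lifted vector is
  what the recovery row returns.\<close>

lemma kernel_bidiag_eq_dual_lift: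
  assumes u: "u \<in> carrier_vec (Suc t * s)" and ker: "bidiag x lo t s *\<^sub>v u = 0\<^sub>v (t * s)"
    and a: "coords_of_one x lo t a"
  shows "u = dual_lift x lo t s (vec s (\<lambda>c. \<Sum>j<Suc t. Polynomial.smult (a (lo + t - j)) (u $ (j * s + c))))"
proof (rule eq_vec_blocksI[OF u dual_lift_carrier])
  fix r c assume rc: "r < Suc t" "c < s"
  define f where "f i = u $ ((lo + t - i) * s + c)" for i
  have rec: "gam x (i+2) * f (Suc i) = gam x i * f i" if i: "lo \<le> i" "Suc i < Suc (lo + t)" for i
  proof -
    define q where "q = lo + t - Suc i"
    have q: "q < t" "lo + t - i = Suc q" "Suc (lo + t) - q = i + 2" "Suc (lo + t) - 2 - q = i"
      using i by (auto simp: q_def)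
    have "0 = (bidiag x lo t s *\<^sub>v u) $ (q * s + c)"
      using block_index_less[OF q(1) rc(2)] by (simp add: ker)
    also have "\<dots> = gam x (i + 2) * u $ (q * s + c) - gam x i * u $ (Suc q * s + c)"
      using u q rc by (subst bidiag_pencil_mult_vec) (simp_all only: q)
    finally show ?thesis
      by (simp add: f_def q q_def[symmetric])
  qed
  have "f (lo + t - r) = nu x lo (Suc (lo + t)) (lo + t - r) *
      (\<Sum>j=lo..<Suc (lo + t). Polynomial.smult (a j) (f j))"
    using rc a unfolding coords_of_one_def nub_def
    by (intro recurrence_solution[OF rec]) (auto simp: sum_reversed_block_index[of "\<lambda>i _. Polynomial.smult (a i) (nu x lo (Suc (lo + t)) i)"]
        simp del: sum.lessThan_Suc sum.op_ivl_Suc)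
  moreover have "(\<Sum>j=lo..<Suc (lo + t). Polynomial.smult (a j) (f j)) =
      (\<Sum>j<Suc t. Polynomial.smult (a (lo + t - j)) (u $ (j * s + c)))"
    unfolding f_def
    by (rule sum_reversed_block_index[of "\<lambda>i r. Polynomial.smult (a i) (u $ (r * s + c))"])
  ultimately show "u $ (r * s + c) = dual_lift x lo t s
      (vec s (\<lambda>c. \<Sum>j<Suc t. Polynomial.smult (a (lo + t - j)) (u $ (j * s + c)))) $ (r * s + c)"
    using rc by (simp only: dual_lift_index less_Suc_eq_le index_vec nub_def) (simp add: f_def)
qed

lemma coords_dual_lift:
  assumes "coords_of_one x lo t a" "c < s"
  shows "(\<Sum>j<Suc t. Polynomial.smult (a (lo + t - j)) (dual_lift x lo t s v $ (j * s + c))) = v $ c"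
proof -
  have "(\<Sum>j<Suc t. Polynomial.smult (a (lo + t - j)) (dual_lift x lo t s v $ (j * s + c))) =
      (\<Sum>j<Suc t. Polynomial.smult (a (lo + t - j)) (nub x lo t j)) * v $ c"
    unfolding sum_distrib_right using assms(2)
    by (intro sum.cong refl) (simp add: dual_lift_index)
  then show ?thesis
    using assms(1) by (simp add: coords_of_one_def)
qed

text \<open>Padding by zeros at both ends absorbs the first and the last block row of the transposed
  pencil, which have a single nonzero block.\<close>

definition block_seq :: "nat \<Rightarrow> nat \<Rightarrow> nat \<Rightarrow> poly_vec \<Rightarrow> nat \<Rightarrow> nat \<Rightarrow> complex poly" where
  "block_seq lo t s w c i = (if lo < i \<and> i \<le> lo + t then w $ ((lo + t - i) * s + c) else 0)"

lemma transpose_bidiag_carrier: "(bidiag x lo t s)\<^sup>T \<in> carrier_mat (Suc t * s) (t * s)"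
  using bidiag_pencil_carrier by simp

lemma transpose_bidiag_mult_vec:
  assumes "w \<in> carrier_vec (t * s)" "c < s" "lo \<le> i" "i < Suc (lo + t)"
  shows "((bidiag x lo t s)\<^sup>T *\<^sub>v w) $ ((lo + t - i) * s + c) =
    gam x (i+1) * block_seq lo t s w c i - gam x i * block_seq lo t s w c (i+1)"
proof -
  define r where "r = lo + t - i"
  have r: "r \<le> t" "i = lo + t - r"
    using assms by (auto simp: r_def)
  have "((bidiag x lo t s)\<^sup>T *\<^sub>v w) $ (r * s + c) =
    (if r < t then gam x (Suc (lo + t) - r) * w $ (r * s + c) else 0)
    - (if 0 < r then gam x (Suc (lo + t) - 1 - r) * w $ ((r - 1) * s + c) else 0)"
    by (rule transpose_bidiag_pencil_mult_vec[OF assms(1) r(1) assms(2)])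
  also have "\<dots> = gam x (i+1) * block_seq lo t s w c i - gam x i * block_seq lo t s w c (i+1)"
    using r by (auto simp: block_seq_def Suc_diff_le)
  finally show ?thesis
    by (simp add: r_def)
qed

text \<open>The identity \<open>N\<^sub>2 K\<^sub>2\<^sup>T = 0\<close>, where the padding in
  \<open>block_seq\<close> supplies the boundary values for telescoping.\<close>

lemma nub_transpose_bidiag:
  assumes "w \<in> carrier_vec (t * s)" "c < s"
  shows "(\<Sum>r<Suc t. nub x lo t r * ((bidiag x lo t s)\<^sup>T *\<^sub>v w) $ (r * s + c)) = 0"
proof -
  have "(\<Sum>i=lo..<Suc (lo + t). nu x lo (Suc (lo + t)) i * ((bidiag x lo t s)\<^sup>T *\<^sub>v w) $ ((lo + t - i) * s + c)) =
      (\<Sum>i=lo..<Suc (lo + t). nu x lo (Suc (lo + t)) i *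
        (gam x (i+1) * block_seq lo t s w c i - gam x i * block_seq lo t s w c (i+1)))"
    by (intro sum.cong refl) (subst transpose_bidiag_mult_vec[OF assms], auto)
  also have "\<dots> = 0"
    by (rule transposed_recurrence_annihilated) (auto simp: block_seq_def)
  finally show ?thesis
    unfolding nub_def
    by (simp only: sum_reversed_block_index[of "\<lambda>i r. nu x lo (Suc (lo + t)) i *
        ((bidiag x lo t s)\<^sup>T *\<^sub>v w) $ (r * s + c)"])
qed

text \<open>The positions inside the blocks decouple: one scalar recurrence is solved for each
  \<open>c\<close> and the solutions are interleaved into \<open>w\<close>, leaving out the two zero
  boundary values.\<close>

lemma transpose_bidiag_solvable:
  assumes y: "y \<in> carrier_vec (Suc t * s)" and lo: "1 \<le> lo" and inj: "inj_on x {lo..Suc (lo + t)}"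
    and ann: "\<And>c. c < s \<Longrightarrow> (\<Sum>r<Suc t. nub x lo t r * y $ (r * s + c)) = 0"
  obtains w where "w \<in> carrier_vec (t * s)" "(bidiag x lo t s)\<^sup>T *\<^sub>v w = y"
proof -
  have "\<exists>f. f lo = 0 \<and> f (Suc (lo + t)) = 0 \<and>
      (\<forall>i\<in>{lo..<Suc (lo + t)}. gam x (i+1) * f i - gam x i * f (i+1) = y $ ((lo + t - i) * s + c))"
    if "c < s" for c
  proof (rule transposed_recurrence_solvable[OF lo _ inj])
    show "(\<Sum>i=lo..<Suc (lo + t). nu x lo (Suc (lo + t)) i * y $ ((lo + t - i) * s + c)) = 0"
      using ann[OF that] unfolding nub_def
      by (simp only: sum_reversed_block_index[of "\<lambda>i r. nu x lo (Suc (lo + t)) i * y $ (r * s + c)"])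
  qed simp
  then obtain f where f: "\<And>c. c < s \<Longrightarrow> f c lo = 0" "\<And>c. c < s \<Longrightarrow> f c (Suc (lo + t)) = 0"
    "\<And>c i. c < s \<Longrightarrow> lo \<le> i \<Longrightarrow> i < Suc (lo + t) \<Longrightarrow>
        gam x (i+1) * f c i - gam x i * f c (i+1) = y $ ((lo + t - i) * s + c)"
    by (metis atLeastLessThan_iff)
  define w where "w = vec (t * s) (\<lambda>i. f (i mod s) (lo + t - i div s))"
  have w: "w \<in> carrier_vec (t * s)"
    by (simp add: w_def)
  have seq: "block_seq lo t s w c i = f c i" if "c < s" "lo \<le> i" "i \<le> Suc (lo + t)" for c i
    using that f(1,2)[OF that(1)] block_index_less[of "lo + t - i" t c s]
    by (auto simp: block_seq_def w_def le_less)
  have "(bidiag x lo t s)\<^sup>T *\<^sub>v w = y"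
  proof (rule eq_vec_blocksI[OF _ y])
    fix r c assume rc: "r < Suc t" "c < s"
    then have i: "lo \<le> lo + t - r" "lo + t - r < Suc (lo + t)" "lo + t - (lo + t - r) = r" by auto
    show "((bidiag x lo t s)\<^sup>T *\<^sub>v w) $ (r * s + c) = y $ (r * s + c)"
      using transpose_bidiag_mult_vec[OF w rc(2) i(1,2), of x] f(3)[OF rc(2) i(1,2)] seq[OF rc(2)] i by simp
  qed (rule mult_mat_vec_carrier[OF transpose_bidiag_carrier w])
  with w show thesis by (rule that)
qed

lemma degree_transpose_bidiag_solution:
  assumes w: "w \<in> carrier_vec (t * s)"
    and deg: "\<And>i. i < Suc t * s \<Longrightarrow> degree (((bidiag x lo t s)\<^sup>T *\<^sub>v w) $ i) \<le> D + 1"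
    and j: "j < t * s"
  shows "degree (w $ j) \<le> D"
proof -
  from j have s: "s > 0" by (cases s) auto
  define r c where "r = j div s" and "c = j mod s"
  have rc: "r < t" "c < s" "j = r * s + c"
    using j s by (auto simp: r_def c_def less_mult_imp_div_less)
  have "degree (block_seq lo t s w c (lo + t - r)) \<le> D"
  proof (rule transposed_recurrence_degree[where lo = lo and hi = "Suc (lo + t)"])
    show "gam x (i+1) * block_seq lo t s w c i - gam x i * block_seq lo t s w c (i+1) =
        ((bidiag x lo t s)\<^sup>T *\<^sub>v w) $ ((lo + t - i) * s + c)" if "lo \<le> i" "i < Suc (lo + t)" for i
      using transpose_bidiag_mult_vec[OF w rc(2) that] by simp
    show "degree (((bidiag x lo t s)\<^sup>T *\<^sub>v w) $ ((lo + t - i) * s + c)) \<le> D + 1"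
      if "lo \<le> i" "i < Suc (lo + t)" for i
      using that rc by (intro deg block_index_less) auto
  qed (use rc in \<open>auto simp: block_seq_def\<close>)
  moreover have "lo + t - (lo + t - r) = r" "lo < lo + t - r"
    using rc by auto
  ultimately show ?thesis
    using rc by (simp add: block_seq_def)
qed

lemma transpose_bidiag_inj:
  assumes w: "w \<in> carrier_vec (t * s)" and ker: "(bidiag x lo t s)\<^sup>T *\<^sub>v w = 0\<^sub>v (Suc t * s)"
  shows "w = 0\<^sub>v (t * s)"
proof (rule eq_vec_blocksI[OF w])
  fix r c assume rc: "r < t" "c < s"
  have "block_seq lo t s w c (lo + t - r) = 0"
  proof (rule transposed_recurrence_unique[where lo = lo and hi = "Suc (lo + t)"])
    fix i assume i: "lo \<le> i" "i < Suc (lo + t)"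
    then have "(lo + t - i) * s + c < Suc t * s"
      using rc by (intro block_index_less) auto
    then show "gam x (i+1) * block_seq lo t s w c i - gam x i * block_seq lo t s w c (i+1) = 0"
      using transpose_bidiag_mult_vec[OF w rc(2) i, of x] by (simp add: ker)
  qed (use rc in \<open>auto simp: block_seq_def\<close>)
  moreover have "lo + t - (lo + t - r) = r" "lo < lo + t - r"
    using rc by auto
  ultimately show "w $ (r * s + c) = 0\<^sub>v (t * s) $ (r * s + c)"
    using rc block_index_less[OF rc] by (simp add: block_seq_def)
qed simp

section \<open>Kernels of block minimal bases pencils\<close>

lemma mult_mat_vec_zero: "C \<in> carrier_mat d e \<Longrightarrow> C *\<^sub>v 0\<^sub>v e = (0\<^sub>v d :: poly_vec)"
  and zero_mat_mult_vec: "v \<in> carrier_vec e \<Longrightarrow> 0\<^sub>m d e *\<^sub>v v = (0\<^sub>v d :: poly_vec)"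
  by auto

text \<open>Both index ranges and both block sizes are parameters, so that the transposed pencil is
  an instance with the two families exchanged. The nodes of the second range are distinct because
  \<open>K2T\<close> is to be solved over the polynomials; the bounds on \<open>M\<close> and
  \<open>B\<close> control the degree of that solution. \<open>Q_eq\<close> is
  \<open>N\<^sub>2 M N\<^sub>1\<^sup>T = Q\<close> entrywise.\<close>

locale block_minimal_bases_pencil =
  fixes x :: "nat \<Rightarrow> complex" and lo1 t1 lo2 t2 m n :: nat
    and M A B Q :: poly_mat and b :: "nat \<Rightarrow> complex"
  assumes lo2: "1 \<le> lo2" and nodes: "inj_on x {lo2..Suc (lo2 + t2)}"
    and n: "1 \<le> n"
    and M: "M \<in> carrier_mat (Suc t2 * m) (Suc t1 * n)"
    and A: "A \<in> carrier_mat (Suc t2 * m) (t1 * n)"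
    and B: "B \<in> carrier_mat (t2 * m) (Suc t1 * n)"
    and Q: "Q \<in> carrier_mat m n"
    and degree_M: "\<And>i j. i < Suc t2 * m \<Longrightarrow> j < Suc t1 * n \<Longrightarrow> degree (M $$ (i, j)) \<le> 1"
    and degree_B: "\<And>i j. i < t2 * m \<Longrightarrow> j < Suc t1 * n \<Longrightarrow> degree (B $$ (i, j)) = 0"
    and Q_eq: "\<And>e c. e < m \<Longrightarrow> c < n \<Longrightarrow> Q $$ (e, c) =
        (\<Sum>r<Suc t2. \<Sum>j<Suc t1. nub x lo2 t2 r * nub x lo1 t1 j * M $$ (r * m + e, j * n + c))"
    and b: "coords_of_one x lo1 t1 b"
begin

abbreviation "K1 \<equiv> bidiag x lo1 t1 n"
abbreviation "K2T \<equiv> (bidiag x lo2 t2 m)\<^sup>T"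

definition L :: poly_mat where
  "L = four_block_mat (M + A * K1 + K2T * B) K2T K1 (0\<^sub>m (t1 * n) (t2 * m))"

abbreviation "R \<equiv> coord_row n (lo1 + t1) (Suc t1) (t2 * m) b"

lemma K1: "K1 \<in> carrier_mat (t1 * n) (Suc t1 * n)"
  by (rule bidiag_pencil_carrier)

lemmas K2T = transpose_bidiag_carrier[of x lo2 t2 m]

declare mult_Suc [simp del] sum.lessThan_Suc [simp del] index_mult_mat_vec [simp del]

lemmas [simp] = carrier_matD[OF M] carrier_matD[OF A] carrier_matD[OF B] carrier_matD[OF Q]
  carrier_matD[OF bidiag_pencil_carrier] carrier_vecD[OF dual_lift_carrier]
  carrier_matD[OF coord_row_carrier]

lemma L_top_left: "M + A * K1 + K2T * B \<in> carrier_mat (Suc t2 * m) (Suc t1 * n)"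
  using mult_carrier_mat[OF A K1] mult_carrier_mat[OF K2T B] by (intro add_carrier_mat)

lemma L_carrier: "L \<in> carrier_mat (Suc t2 * m + t1 * n) (Suc t1 * n + t2 * m)"
  unfolding L_def by (rule four_block_carrier_mat[OF L_top_left]) simp

text \<open>The term with \<open>A\<close> vanishes once \<open>K1\<close> annihilates
  \<open>u\<close>, and the term with \<open>B\<close> is absorbed into the unknown of the
  transposed pencil.\<close>

lemma L_mult_vec_eq_0_iff:
  assumes u: "u \<in> carrier_vec (Suc t1 * n)" and v: "v \<in> carrier_vec (t2 * m)"
  shows "L *\<^sub>v (u @\<^sub>v v) = 0\<^sub>v (Suc t2 * m + t1 * n) \<longleftrightarrow>
    K1 *\<^sub>v u = 0\<^sub>v (t1 * n) \<and> M *\<^sub>v u + K2T *\<^sub>v (B *\<^sub>v u + v) = 0\<^sub>v (Suc t2 * m)"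
proof -
  note carr = mult_mat_vec_carrier[OF M u] mult_mat_vec_carrier[OF K1 u] mult_mat_vec_carrier[OF B u]
    mult_mat_vec_carrier[OF K2T v]
  have AK: "A * K1 \<in> carrier_mat (Suc t2 * m) (Suc t1 * n)" and KB: "K2T * B \<in> carrier_mat (Suc t2 * m) (Suc t1 * n)"
    using mult_carrier_mat[OF A K1] mult_carrier_mat[OF K2T B] by auto
  note carr2 = mult_mat_vec_carrier[OF A carr(2)] mult_mat_vec_carrier[OF K2T carr(3)]
  have "L *\<^sub>v (u @\<^sub>v v) = ((M + A * K1 + K2T * B) *\<^sub>v u + K2T *\<^sub>v v) @\<^sub>v (K1 *\<^sub>v u + 0\<^sub>m (t1 * n) (t2 * m) *\<^sub>v v)"
    unfolding L_def by (rule four_block_mat_mult_vec[OF L_top_left K2T K1 _ u v]) simp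
  also have "0\<^sub>m (t1 * n) (t2 * m) *\<^sub>v v = 0\<^sub>v (t1 * n)"
    using v by (rule zero_mat_mult_vec)
  also have "K1 *\<^sub>v u + 0\<^sub>v (t1 * n) = K1 *\<^sub>v u"
    using carr(2) by simp
  also have "(M + A * K1 + K2T * B) *\<^sub>v u = M *\<^sub>v u + A *\<^sub>v (K1 *\<^sub>v u) + K2T *\<^sub>v (B *\<^sub>v u)"
    using M AK KB u by (simp only: add_mult_distrib_mat_vec[of _ "Suc t2 * m" "Suc t1 * n"] add_carrier_mat
        assoc_mult_mat_vec[OF A K1 u] assoc_mult_mat_vec[OF K2T B u])
  also have "M *\<^sub>v u + A *\<^sub>v (K1 *\<^sub>v u) + K2T *\<^sub>v (B *\<^sub>v u) + K2T *\<^sub>v v =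
      M *\<^sub>v u + A *\<^sub>v (K1 *\<^sub>v u) + K2T *\<^sub>v (B *\<^sub>v u + v)"
    unfolding mult_add_distrib_mat_vec[OF K2T carr(3) v]
    using carr carr2 by (intro assoc_add_vec[of _ "Suc t2 * m"]) auto
  finally have eq: "L *\<^sub>v (u @\<^sub>v v) =
      (M *\<^sub>v u + A *\<^sub>v (K1 *\<^sub>v u) + K2T *\<^sub>v (B *\<^sub>v u + v)) @\<^sub>v (K1 *\<^sub>v u)" .
  have zero: "0\<^sub>v (Suc t2 * m + t1 * n) = 0\<^sub>v (Suc t2 * m) @\<^sub>v (0\<^sub>v (t1 * n) :: poly_vec)"
    by auto
  have Kv: "K2T *\<^sub>v (B *\<^sub>v u + v) \<in> carrier_vec (Suc t2 * m)"
    by (rule mult_mat_vec_carrier[OF K2T add_carrier_vec[OF carr(3) v]])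
  have "L *\<^sub>v (u @\<^sub>v v) = 0\<^sub>v (Suc t2 * m + t1 * n) \<longleftrightarrow>
      M *\<^sub>v u + A *\<^sub>v (K1 *\<^sub>v u) + K2T *\<^sub>v (B *\<^sub>v u + v) = 0\<^sub>v (Suc t2 * m) \<and> K1 *\<^sub>v u = 0\<^sub>v (t1 * n)"
    unfolding eq zero using carr carr2 Kv
    by (intro append_vec_eq add_carrier_vec) auto
  moreover have "M *\<^sub>v u + A *\<^sub>v 0\<^sub>v (t1 * n) = M *\<^sub>v u"
    using carr(1) by (simp add: mult_mat_vec_zero[OF A])
  ultimately show ?thesis
    by auto
qed

lemma Q_mult_vec:
  assumes p: "p \<in> carrier_vec n" and e: "e < m"
  shows "(\<Sum>r<Suc t2. nub x lo2 t2 r * (M *\<^sub>v dual_lift x lo1 t1 n p) $ (r * m + e)) = (Q *\<^sub>v p) $ e"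
proof -
  have "(M *\<^sub>v dual_lift x lo1 t1 n p) $ (r * m + e) =
      (\<Sum>j<Suc t1. \<Sum>c<n. M $$ (r * m + e, j * n + c) * (nub x lo1 t1 j * p $ c))" if "r < Suc t2" for r
    unfolding mult_mat_vec_blocks[OF M dual_lift_carrier block_index_less[OF that e]]
    by (intro sum.cong refl) (simp add: dual_lift_index)
  then have "(\<Sum>r<Suc t2. nub x lo2 t2 r * (M *\<^sub>v dual_lift x lo1 t1 n p) $ (r * m + e)) =
      (\<Sum>r<Suc t2. \<Sum>j<Suc t1. \<Sum>c<n. nub x lo2 t2 r * nub x lo1 t1 j * M $$ (r * m + e, j * n + c) * p $ c)"
    by (intro sum.cong refl) (simp add: sum_distrib_left algebra_simps)
  also have "\<dots> = (\<Sum>r<Suc t2. \<Sum>c<n. \<Sum>j<Suc t1. nub x lo2 t2 r * nub x lo1 t1 j * M $$ (r * m + e, j * n + c) * p $ c)"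
    by (intro sum.cong refl sum.swap)
  also have "\<dots> = (\<Sum>c<n. \<Sum>r<Suc t2. \<Sum>j<Suc t1. nub x lo2 t2 r * nub x lo1 t1 j * M $$ (r * m + e, j * n + c) * p $ c)"
    by (rule sum.swap)
  also have "\<dots> = (\<Sum>c<n. Q $$ (e, c) * p $ c)"
    by (intro sum.cong refl) (simp add: Q_eq[OF e] sum_distrib_right)
  also have "\<dots> = (Q *\<^sub>v p) $ e"
    using p e by (simp add: scalar_prod_def lessThan_atLeast0 index_mult_mat_vec)
  finally show ?thesis .
qed

lemma R_mult_vec:
  assumes "u \<in> carrier_vec (Suc t1 * n)" "v \<in> carrier_vec (t2 * m)"
  shows "R *\<^sub>v (u @\<^sub>v v) =
    vec n (\<lambda>c. \<Sum>j<Suc t1. Polynomial.smult (b (lo1 + t1 - j)) (u $ (j * n + c)))"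
  using coord_row_mult_vec[OF assms] coord_row_carrier[of n "lo1 + t1" "Suc t1" "t2 * m" b]
  by (intro eq_vecI) auto

text \<open>Parametrises the kernel by \<open>p\<close> and \<open>w\<close>: the lower block row
  makes \<open>u\<close> a dual lift of \<open>R z\<close>, and \<open>w\<close> is
  \<open>B u + v\<close>.\<close>

lemma kernel_elim:
  assumes z: "z \<in> carrier_vec (Suc t1 * n + t2 * m)" and ker: "L *\<^sub>v z = 0\<^sub>v (Suc t2 * m + t1 * n)"
  obtains p w where "p \<in> carrier_vec n" "w \<in> carrier_vec (t2 * m)" "R *\<^sub>v z = p"
    "z = dual_lift x lo1 t1 n p @\<^sub>v (w - B *\<^sub>v dual_lift x lo1 t1 n p)"
    "M *\<^sub>v dual_lift x lo1 t1 n p + K2T *\<^sub>v w = 0\<^sub>v (Suc t2 * m)"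
proof -
  define u v where "u = vec_first z (Suc t1 * n)" and "v = vec_last z (t2 * m)"
  have u: "u \<in> carrier_vec (Suc t1 * n)" and v: "v \<in> carrier_vec (t2 * m)"
    by (simp_all add: u_def v_def)
  have z_eq: "z = u @\<^sub>v v"
    using z by (simp add: u_def v_def)
  from ker have *: "K1 *\<^sub>v u = 0\<^sub>v (t1 * n)" "M *\<^sub>v u + K2T *\<^sub>v (B *\<^sub>v u + v) = 0\<^sub>v (Suc t2 * m)"
    unfolding z_eq L_mult_vec_eq_0_iff[OF u v] by auto
  have u_eq: "u = dual_lift x lo1 t1 n (R *\<^sub>v z)"
    unfolding z_eq R_mult_vec[OF u v] by (rule kernel_bidiag_eq_dual_lift[OF u *(1) b])
  have Bu: "B *\<^sub>v u \<in> carrier_vec (t2 * m)"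
    using B u by (rule mult_mat_vec_carrier)
  have "v = (B *\<^sub>v u + v) - B *\<^sub>v u"
    using Bu v by (intro eq_vecI) auto
  then show thesis
    using that[OF _ _ refl, of "B *\<^sub>v u + v"] * Bu v z_eq
      mult_mat_vec_carrier[OF coord_row_carrier z] unfolding u_eq[symmetric]
    by simp
qed

text \<open>Combining the block rows with the dual basis of the second pencil kills
  \<open>K2T w\<close> and turns the rest into \<open>Q p\<close>.\<close>

lemma Q_mult_vec_eq_0_if:
  assumes p: "p \<in> carrier_vec n" and w: "w \<in> carrier_vec (t2 * m)"
    and eq: "M *\<^sub>v dual_lift x lo1 t1 n p + K2T *\<^sub>v w = 0\<^sub>v (Suc t2 * m)"
  shows "Q *\<^sub>v p = 0\<^sub>v m"
proof (rule eq_vecI)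
  fix e assume "e < dim_vec (0\<^sub>v m)"
  then have e: "e < m" by simp
  let ?u = "dual_lift x lo1 t1 n p"
  have "(M *\<^sub>v ?u) $ (r * m + e) = - (K2T *\<^sub>v w) $ (r * m + e)" if "r < Suc t2" for r
  proof -
    have i: "r * m + e < Suc t2 * m"
      using that e by (rule block_index_less)
    have "(M *\<^sub>v ?u + K2T *\<^sub>v w) $ (r * m + e) = (M *\<^sub>v ?u) $ (r * m + e) + (K2T *\<^sub>v w) $ (r * m + e)"
      using i mult_mat_vec_carrier[OF K2T w] by (intro index_add_vec) auto
    then show ?thesis
      using i unfolding eq by (simp add: eq_neg_iff_add_eq_0)
  qed
  then have "(\<Sum>r<Suc t2. nub x lo2 t2 r * (M *\<^sub>v ?u) $ (r * m + e)) =
      - (\<Sum>r<Suc t2. nub x lo2 t2 r * (K2T *\<^sub>v w) $ (r * m + e))"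
    unfolding sum_negf[symmetric] by (intro sum.cong refl) simp
  then show "(Q *\<^sub>v p) $ e = 0\<^sub>v m $ e"
    unfolding Q_mult_vec[OF p e] nub_transpose_bidiag[OF w e] using e by simp
qed (use Q in simp)

text \<open>The equation \<open>K2T w = - M u\<close> is solvable when the dual basis annihilates
  its right-hand side, and for \<open>u\<close> lifted from \<open>p\<close> this condition reads
  \<open>Q p = 0\<close>.\<close>

lemma kernel_intro:
  assumes p: "p \<in> carrier_vec n" and ker: "Q *\<^sub>v p = 0\<^sub>v m"
  obtains z where "z \<in> carrier_vec (Suc t1 * n + t2 * m)" "L *\<^sub>v z = 0\<^sub>v (Suc t2 * m + t1 * n)" "R *\<^sub>v z = p"
proof -
  let ?u = "dual_lift x lo1 t1 n p"
  have u: "?u \<in> carrier_vec (Suc t1 * n)" by simp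
  have Mu: "M *\<^sub>v ?u \<in> carrier_vec (Suc t2 * m)" and Bu: "B *\<^sub>v ?u \<in> carrier_vec (t2 * m)"
    by (rule mult_mat_vec_carrier[OF M u] mult_mat_vec_carrier[OF B u])+
  have "(\<Sum>r<Suc t2. nub x lo2 t2 r * (- (M *\<^sub>v ?u)) $ (r * m + e)) = 0" if e: "e < m" for e
  proof -
    have "(\<Sum>r<Suc t2. nub x lo2 t2 r * (- (M *\<^sub>v ?u)) $ (r * m + e)) =
        - (\<Sum>r<Suc t2. nub x lo2 t2 r * (M *\<^sub>v ?u) $ (r * m + e))"
      unfolding sum_negf[symmetric] using block_index_less[of _ "Suc t2" e m] e Mu
      by (intro sum.cong refl) (simp)
    also have "\<dots> = 0"
      unfolding Q_mult_vec[OF p e] ker using e by simp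
    finally show ?thesis .
  qed
  then obtain w where w: "w \<in> carrier_vec (t2 * m)" "K2T *\<^sub>v w = - (M *\<^sub>v ?u)"
    using transpose_bidiag_solvable[of "- (M *\<^sub>v ?u)" t2 m lo2 x] Mu lo2 nodes by auto
  let ?v = "w - B *\<^sub>v ?u"
  have v: "?v \<in> carrier_vec (t2 * m)"
    using w Bu by simp
  have "B *\<^sub>v ?u + ?v = w"
    using w(1) Bu by (intro eq_vecI) auto
  then have "L *\<^sub>v (?u @\<^sub>v ?v) = 0\<^sub>v (Suc t2 * m + t1 * n)"
    unfolding L_mult_vec_eq_0_iff[OF u v] using w(2) Mu by (simp add: bidiag_dual_lift)
  moreover have "R *\<^sub>v (?u @\<^sub>v ?v) = p"
    unfolding R_mult_vec[OF u v] using coords_dual_lift[OF b] p by (intro eq_vecI) auto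
  ultimately show thesis
    using that[of "?u @\<^sub>v ?v"] u v by simp
qed

lemma degree_mult_mat_vec:
  assumes "C \<in> carrier_mat d e" "v \<in> carrier_vec e" "i < d"
    and "\<And>j. j < e \<Longrightarrow> degree (C $$ (i, j)) \<le> D1" "\<And>j. j < e \<Longrightarrow> degree (v $ j) \<le> D2"
  shows "degree ((C *\<^sub>v v) $ i) \<le> D1 + (D2 :: nat)"
proof -
  have "(C *\<^sub>v v) $ i = (\<Sum>j<e. C $$ (i, j) * v $ j)"
    using assms(1-3) by (simp add: scalar_prod_def lessThan_atLeast0 index_mult_mat_vec)
  also have "degree \<dots> \<le> D1 + D2"
    using assms(4,5) by (intro degree_sum_le) (auto intro!: order.trans[OF degree_mult_le] add_mono)
  finally show ?thesis .
qed

lemma degree_dual_lift: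
  assumes "p \<in> carrier_vec n" "i < Suc t1 * n"
  shows "degree (dual_lift x lo1 t1 n p $ i) \<le> t1 + vec_degree p"
proof -
  have rc: "i div n \<le> t1" "i mod n < n"
    using assms(2) n by (auto simp: less_mult_imp_div_less less_Suc_eq_le[symmetric])
  have "degree (dual_lift x lo1 t1 n p $ (i div n * n + i mod n)) \<le> t1 + vec_degree p"
    unfolding dual_lift_index[OF rc] using rc assms(1)
    by (intro order.trans[OF degree_mult_le] add_mono degree_le_vec_degree) (simp_all add: degree_nub)
  then show ?thesis by simp
qed

text \<open>Upper bound: \<open>K2T w = - M u\<close> costs one degree on the right and regains it
  on the left, so \<open>w\<close> obeys the bound of \<open>u\<close>, and so does
  \<open>B u\<close>. Lower bound: the first block of \<open>u\<close> is a multiple of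
  \<open>p\<close> by a nonzero polynomial of degree \<open>t1\<close>.\<close>

lemma vec_degree_kernel:
  assumes p: "p \<in> carrier_vec n" "p \<noteq> 0\<^sub>v n" and w: "w \<in> carrier_vec (t2 * m)"
    and eq: "M *\<^sub>v dual_lift x lo1 t1 n p + K2T *\<^sub>v w = 0\<^sub>v (Suc t2 * m)"
  shows "vec_degree (dual_lift x lo1 t1 n p @\<^sub>v (w - B *\<^sub>v dual_lift x lo1 t1 n p)) = vec_degree p + t1"
proof (rule antisym)
  let ?u = "dual_lift x lo1 t1 n p" and ?D = "t1 + vec_degree p"
  let ?z = "?u @\<^sub>v (w - B *\<^sub>v ?u)"
  have u: "?u \<in> carrier_vec (Suc t1 * n)" by simp
  note du = degree_dual_lift[OF p(1)]
  have Bu: "B *\<^sub>v ?u \<in> carrier_vec (t2 * m)" and Kw: "K2T *\<^sub>v w \<in> carrier_vec (Suc t2 * m)"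
    by (rule mult_mat_vec_carrier[OF B u] mult_mat_vec_carrier[OF K2T w])+
  have dB: "degree ((B *\<^sub>v ?u) $ i) \<le> ?D" if "i < t2 * m" for i
    using degree_mult_mat_vec[OF B u that, of 0 ?D] degree_B[OF that] du by simp
  have "degree ((K2T *\<^sub>v w) $ i) \<le> ?D + 1" if i: "i < Suc t2 * m" for i
  proof -
    have "(M *\<^sub>v ?u + K2T *\<^sub>v w) $ i = (M *\<^sub>v ?u) $ i + (K2T *\<^sub>v w) $ i"
      using i Kw by (intro index_add_vec) auto
    then have "(K2T *\<^sub>v w) $ i = - (M *\<^sub>v ?u) $ i"
      unfolding eq using i by (simp add: eq_neg_iff_add_eq_0 add.commute)
    then show ?thesis
      using degree_mult_mat_vec[OF M u i, of 1 ?D] degree_M[OF i] du by simp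
  qed
  then have dw: "degree (w $ i) \<le> ?D" if "i < t2 * m" for i
    using degree_transpose_bidiag_solution[OF w _ that, of x lo2] by blast
  have dim: "dim_vec ?z = Suc t1 * n + t2 * m"
    using u Bu by simp
  then have pos: "dim_vec ?z > 0"
    using n by simp
  have "degree (?z $ i) \<le> ?D" if i: "i < dim_vec ?z" for i
  proof (cases "i < Suc t1 * n")
    case True
    then show ?thesis
      using du u i by simp
  next
    case False
    define j where "j = i - Suc t1 * n"
    have "?z $ i = w $ j - (B *\<^sub>v ?u) $ j" "j < t2 * m"
      using False u i dim Bu w by (auto simp: j_def)
    then show ?thesis
      using dB dw by (auto intro: degree_diff_le)
  qed
  then show "vec_degree ?z \<le> vec_degree p + t1"
    unfolding vec_degree_le_iff[OF pos] by (simp add: add.commute)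
  obtain c where c: "c < n" "p $ c \<noteq> 0" "degree (p $ c) = vec_degree p"
    using vec_degree_attained[OF p] .
  have "c < Suc t1 * n"
    using block_index_less[of 0 "Suc t1" c n] c(1) by simp
  moreover have "?u $ c = nub x lo1 t1 0 * p $ c"
    using dual_lift_index[of 0 t1 c n] c(1) by simp
  ultimately have "degree (?z $ c) = t1 + vec_degree p"
    using c u dim nub_nonzero[of 0 t1 x lo1] by (simp add: degree_mult_eq degree_nub)
  then show "vec_degree p + t1 \<le> vec_degree ?z"
    using degree_le_vec_degree[of c ?z] \<open>c < Suc t1 * n\<close> unfolding dim by simp
qed

lemma nullspace_recovery: "nullspace_recovery L Q R t1"
proof
  have dims: "dim_row L = Suc t2 * m + t1 * n" "dim_col L = Suc t1 * n + t2 * m" "dim_row Q = m" "dim_col Q = n"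
    using L_carrier Q by auto
  show "R \<in> carrier_mat (dim_col Q) (dim_col L)"
    unfolding dims by (rule coord_row_carrier)
  show "\<exists>z\<in>carrier_vec (dim_col L). L *\<^sub>v z = 0\<^sub>v (dim_row L) \<and> R *\<^sub>v z = p"
    if "p \<in> carrier_vec (dim_col Q)" "Q *\<^sub>v p = 0\<^sub>v (dim_row Q)" for p
    using that unfolding dims by (meson kernel_intro)
  fix z assume z: "z \<in> carrier_vec (dim_col L)" "L *\<^sub>v z = 0\<^sub>v (dim_row L)"
  then obtain p w where pw: "p \<in> carrier_vec n" "w \<in> carrier_vec (t2 * m)" "R *\<^sub>v z = p"
    "z = dual_lift x lo1 t1 n p @\<^sub>v (w - B *\<^sub>v dual_lift x lo1 t1 n p)"
    "M *\<^sub>v dual_lift x lo1 t1 n p + K2T *\<^sub>v w = 0\<^sub>v (Suc t2 * m)"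
    unfolding dims by (rule kernel_elim)
  show "Q *\<^sub>v (R *\<^sub>v z) = 0\<^sub>v (dim_row Q)"
    unfolding dims pw(3) by (rule Q_mult_vec_eq_0_if[OF pw(1,2,5)])
  \<comment> \<open>Used twice: directly for injectivity, and in contrapositive form to obtain a
    nonzero \<open>p\<close> for the degree formula.\<close>
  have zero: "z = 0\<^sub>v (dim_col L)" if "p = 0\<^sub>v n"
  proof -
    have u0: "dual_lift x lo1 t1 n p = 0\<^sub>v (Suc t1 * n)"
      using that by (intro eq_vec_blocksI[OF dual_lift_carrier])
        (simp_all add: dual_lift_index block_index_less)
    have "K2T *\<^sub>v w = 0\<^sub>v (Suc t2 * m)"
      using pw(5) mult_mat_vec_carrier[OF K2T pw(2)] unfolding u0 mult_mat_vec_zero[OF M] by simp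
    then have "w = 0\<^sub>v (t2 * m)"
      by (rule transpose_bidiag_inj[OF pw(2)])
    then show ?thesis
      unfolding pw(4) u0 dims by (auto simp: mult_mat_vec_zero[OF B])
  qed
  then show "z = 0\<^sub>v (dim_col L)" if "R *\<^sub>v z = 0\<^sub>v (dim_col Q)"
    using that pw(3) unfolding dims by simp
  show "vec_degree z = vec_degree (R *\<^sub>v z) + t1" if "z \<noteq> 0\<^sub>v (dim_col L)"
    using vec_degree_kernel[OF pw(1) _ pw(2,5)] zero that unfolding pw(3) pw(4)[symmetric] by blast
qed

end

section \<open>The pencils in the modified Lagrange basis\<close>

lemma left_nullspace_eq: "left_nullspace P = right_nullspace P\<^sup>T"
proof -
  have "(map_mat to_fract P)\<^sup>T = map_mat to_fract P\<^sup>T"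
    by (rule eq_matI) auto
  then show ?thesis
    by (simp add: left_nullspace_def right_nullspace_def)
qed

lemma left_minimal_basis_eq: "left_minimal_basis P = right_minimal_basis P\<^sup>T"
  and left_minimal_indices_eq: "left_minimal_indices P = right_minimal_indices P\<^sup>T"
  by (simp_all add: left_minimal_basis_def right_minimal_basis_def left_minimal_indices_def
      right_minimal_indices_def left_nullspace_eq)

section \<open>The identity between the block pencil and the Lagrange form\<close>

lemma nprod_split: "a \<le> c \<Longrightarrow> nprod x 1 a * nprod x (Suc a) c = nprod x 1 c"
  unfolding nprod_def
  by (subst prod.union_disjoint[symmetric]) (auto intro!: prod.cong)

lemma ell_div_gam_eqI: "q * gam x i = ell x k \<Longrightarrow> ell x k div gam x i = q"
  by (metis gam_nonzero nonzero_mult_div_cancel_right)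

text \<open>The nonzero blocks of the pencil lie in the first block row and the last block column,
  so these two kinds of products suffice. In the second, the node ranges overlap in
  \<open>\<mu> + 1\<close> and \<open>\<mu> + 2\<close>, and these are the factors missing from the
  bottom entry \<open>nub x (Suc \<mu>) t t\<close>.\<close>

lemma nub_products:
  shows nub_top_times_nub: "j \<le> t \<Longrightarrow> nub x 1 \<mu> 0 * nub x (Suc \<mu>) t j *
      (gam x (Suc \<mu> + t - j + 1) * gam x (Suc \<mu> + t - j)) = ell x (Suc \<mu> + t)"
    and nub_times_nub_bottom: "r \<le> \<mu> \<Longrightarrow> nub x 1 \<mu> r * nub x (Suc \<mu>) t t *
      (gam x (Suc \<mu> - r + 1) * gam x (Suc \<mu> - r)) = ell x (Suc \<mu> + t)"
proof -
  have ell: "nprod x 1 \<mu> * nprod x (Suc \<mu>) (Suc (Suc \<mu> + t)) = ell x (Suc \<mu> + t)"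
    using nprod_split[of \<mu> "Suc (Suc \<mu> + t)" x] by (simp add: ell_def nprod_def)
  have top: "nub x 1 \<mu> 0 = nprod x 1 \<mu>"
    using nu_top[of 1 "Suc \<mu>" x] by (simp add: nub_def)
  have nu1: "nub x (Suc \<mu>) t j * (gam x (Suc \<mu> + t - j + 1) * gam x (Suc \<mu> + t - j)) =
      nprod x (Suc \<mu>) (Suc (Suc \<mu> + t))" if "j \<le> t" for j
    unfolding nub_def using that by (intro nu_mult) auto
  have nu2: "nub x 1 \<mu> r * (gam x (Suc \<mu> - r + 1) * gam x (Suc \<mu> - r)) = nprod x 1 (Suc (Suc \<mu>))"
    if "r \<le> \<mu>" for r
    using nu_mult[of 1 "Suc \<mu> - r" "Suc (Suc \<mu>)" x] that unfolding nub_def by simp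
  show "nub x 1 \<mu> 0 * nub x (Suc \<mu>) t j *
      (gam x (Suc \<mu> + t - j + 1) * gam x (Suc \<mu> + t - j)) = ell x (Suc \<mu> + t)" if "j \<le> t"
    unfolding mult.assoc nu1[OF that] top ell ..
  show "nub x 1 \<mu> r * nub x (Suc \<mu>) t t *
      (gam x (Suc \<mu> - r + 1) * gam x (Suc \<mu> - r)) = ell x (Suc \<mu> + t)" if "r \<le> \<mu>"
  proof -
    \<comment> \<open>Multiplying by the two overlapping factors completes both node products; they
      are cancelled at the end.\<close>
    have "gam x (Suc \<mu>) * gam x (Suc (Suc \<mu>)) * (nub x 1 \<mu> r * nub x (Suc \<mu>) t t *
        (gam x (Suc \<mu> - r + 1) * gam x (Suc \<mu> - r))) =
        nprod x 1 (Suc (Suc \<mu>)) * nprod x (Suc \<mu>) (Suc (Suc \<mu> + t))"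
      unfolding nu1[of t, symmetric, OF order.refl] nu2[OF that, symmetric] by (simp add: algebra_simps)
    also have "nprod x 1 (Suc (Suc \<mu>)) = gam x (Suc \<mu>) * gam x (Suc (Suc \<mu>)) * nprod x 1 \<mu>"
      by (simp add: nprod_def)
    also have "\<dots> * nprod x (Suc \<mu>) (Suc (Suc \<mu> + t)) =
        gam x (Suc \<mu>) * gam x (Suc (Suc \<mu>)) * ell x (Suc \<mu> + t)"
      unfolding mult.assoc ell ..
    finally show ?thesis
      by (simp only: mult_cancel_left mult_eq_0_iff gam_nonzero simp_thms)
  qed
qed

lemma M_Lagr_carrier: "M_Lagr x (Suc \<mu> + t) \<mu> m n P \<in> carrier_mat (Suc \<mu> * m) (Suc t * n)"
proof -
  have "\<mu> + 1 = Suc \<mu>" "Suc \<mu> + t - \<mu> = Suc t" by auto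
  then show ?thesis
    unfolding M_Lagr_def by (simp only: block_mat_carrier)
qed

text \<open>The block pencil with scalar coefficients \<open>p i\<close>: fixing a position inside
  the blocks reduces the matrix identity to this scalar one.\<close>

definition M_coeff ::
    "(nat \<Rightarrow> complex) \<Rightarrow> nat \<Rightarrow> nat \<Rightarrow> (nat \<Rightarrow> complex) \<Rightarrow> nat \<Rightarrow> nat \<Rightarrow> complex poly" where
  "M_coeff x k t p r j =
    (if r = 0 \<and> j = 0 then Polynomial.smult (p (k+1) * wt x k (k+1)) (gam x k)
        + Polynomial.smult (p k * wt x k k) (gam x (k+1))
     else if r = 0 \<or> j = t then Polynomial.smult (p (k-r-j) * wt x k (k-r-j)) (gam x (k-r-j+1))
     else 0)"

lemma M_Lagr_index:
  assumes P: "\<And>i. i \<in> {1..Suc \<mu> + t + 1} \<Longrightarrow> P i \<in> carrier_mat m n"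
    and r: "r < Suc \<mu>" and j: "j < Suc t" and e: "e < m" and c: "c < n"
  shows "M_Lagr x (Suc \<mu> + t) \<mu> m n P $$ (r * m + e, j * n + c) =
    M_coeff x (Suc \<mu> + t) t (\<lambda>i. P i $$ (e, c)) r j"
proof -
  have [simp]: "dim_row (P i) = m" "dim_col (P i) = n" if "1 \<le> i" "i \<le> Suc \<mu> + t + 1" for i
    using P[of i] that by auto
  have "r < \<mu> + 1" "j < Suc \<mu> + t - \<mu>"
    using r j by auto
  then show ?thesis
    unfolding M_Lagr_def M_coeff_def using e c r j
    by (subst block_mat_index) (auto simp: const_poly_mat_def mult.commute)
qed

lemma degree_M_coeff: "degree (M_coeff x k t p r j) \<le> 1"
  unfolding M_coeff_def by (auto intro!: degree_add_le order.trans[OF degree_smult_le])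

lemma degree_M_Lagr:
  assumes P: "\<And>i. i \<in> {1..Suc \<mu> + t + 1} \<Longrightarrow> P i \<in> carrier_mat m n"
    and "i < Suc \<mu> * m" "j < Suc t * n"
  shows "degree (M_Lagr x (Suc \<mu> + t) \<mu> m n P $$ (i, j)) \<le> 1"
proof -
  have "m > 0" "n > 0"
    using assms(2,3) by (cases m; simp; cases n; simp)+
  then have *: "i div m < Suc \<mu>" "i mod m < m" "j div n < Suc t" "j mod n < n"
    using assms(2,3) by (simp_all add: less_mult_imp_div_less)
  have "M_Lagr x (Suc \<mu> + t) \<mu> m n P $$ (i div m * m + i mod m, j div n * n + j mod n) =
      M_coeff x (Suc \<mu> + t) t (\<lambda>l. P l $$ (i mod m, j mod n)) (i div m) (j div n)"
    using P *(1,3,2,4) by (rule M_Lagr_index)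
  then show ?thesis
    using degree_M_coeff by simp
qed

text \<open>The first block row produces the Lagrange terms for \<open>i\<close> from
  \<open>\<mu> + 1\<close> to \<open>k + 1\<close>, and the rest of the last block column those from
  \<open>1\<close> to \<open>\<mu>\<close>.\<close>

lemma sum_nub_M_coeff:
  "(\<Sum>r<Suc \<mu>. \<Sum>j<Suc t. nub x 1 \<mu> r * nub x (Suc \<mu>) t j * M_coeff x (Suc \<mu> + t) t p r j) =
    (\<Sum>i=1..Suc \<mu> + t + 1. Polynomial.smult (p i * wt x (Suc \<mu> + t) i) (ell x (Suc \<mu> + t) div gam x i))"
proof -
  let ?k = "Suc \<mu> + t"
  let ?g = "\<lambda>i. Polynomial.smult (p i * wt x ?k i) (ell x ?k div gam x i)"
  let ?t = "\<lambda>r j. nub x 1 \<mu> r * nub x (Suc \<mu>) t j * M_coeff x ?k t p r j"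
  have lam1: "ell x ?k div gam x (?k - j) = nub x 1 \<mu> 0 * nub x (Suc \<mu>) t j * gam x (?k - j + 1)"
    if "j \<le> t" for j
    using nub_top_times_nub[OF that, of x \<mu>] by (intro ell_div_gam_eqI) (simp add: mult.assoc)
  have lam0: "ell x ?k div gam x (?k + 1) = nub x 1 \<mu> 0 * nub x (Suc \<mu>) t 0 * gam x ?k"
    using nub_top_times_nub[of 0 t x \<mu>] by (intro ell_div_gam_eqI) (simp add: mult_ac)
  have lam2: "ell x ?k div gam x (Suc \<mu> - r) = nub x 1 \<mu> r * nub x (Suc \<mu>) t t * gam x (Suc \<mu> - r + 1)"
    if "r \<le> \<mu>" for r
    using nub_times_nub_bottom[OF that, of x t] by (intro ell_div_gam_eqI) (simp add: mult.assoc)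
  \<comment> \<open>The corner block contributes two terms, for \<open>k\<close> and for
    \<open>k + 1\<close>; the conditional accounts for the second.\<close>
  have t0: "?t 0 j = ?g (?k - j) + (if j = 0 then ?g (?k + 1) else 0)" if "j < Suc t" for j
    using that lam0 lam1[of j] by (auto simp: M_coeff_def algebra_simps)
  have tr: "?t (Suc r) j = (if j = t then ?g (\<mu> - r) else 0)" if "r < \<mu>" "j < Suc t" for r j
    using that lam2[of "Suc r"] by (auto simp: M_coeff_def algebra_simps)
  have "(\<Sum>r<Suc \<mu>. \<Sum>j<Suc t. ?t r j) = (\<Sum>j<Suc t. ?t 0 j) + (\<Sum>r<\<mu>. \<Sum>j<Suc t. ?t (Suc r) j)"
    by (rule sum.lessThan_Suc_shift)
  also have "(\<Sum>j<Suc t. ?t 0 j) = (\<Sum>j<Suc t. ?g (?k - j)) + ?g (?k + 1)"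
  proof -
    have "(\<Sum>j<Suc t. ?t 0 j) = (\<Sum>j<Suc t. ?g (?k - j) + (if j = 0 then ?g (?k + 1) else 0))"
      by (rule sum.cong[OF refl], rule t0) simp
    then show ?thesis
      by (simp add: sum.distrib del: sum.lessThan_Suc)
  qed
  also have "(\<Sum>j<Suc t. ?g (?k - j)) = (\<Sum>i=Suc \<mu>..<Suc ?k. ?g i)"
    by (rule sum_reversed_block_index[symmetric])
  also have "(\<Sum>r<\<mu>. \<Sum>j<Suc t. ?t (Suc r) j) = (\<Sum>r<\<mu>. ?g (\<mu> - r))"
  proof (rule sum.cong[OF refl])
    fix r assume "r \<in> {..<\<mu>}"
    then have "(\<Sum>j<Suc t. ?t (Suc r) j) = (\<Sum>j<Suc t. if j = t then ?g (\<mu> - r) else 0)"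
      by (intro sum.cong[OF refl] tr) simp_all
    then show "(\<Sum>j<Suc t. ?t (Suc r) j) = ?g (\<mu> - r)"
      by (simp del: sum.lessThan_Suc)
  qed
  also have "\<dots> = (\<Sum>i=1..<Suc \<mu>. ?g i)"
    by (rule sum.reindex_bij_witness[of _ "\<lambda>i. \<mu> - i" "\<lambda>r. \<mu> - r"]) auto
  also have "(\<Sum>i=Suc \<mu>..<Suc ?k. ?g i) + ?g (?k + 1) + (\<Sum>i=1..<Suc \<mu>. ?g i) =
      ((\<Sum>i=1..<Suc \<mu>. ?g i) + (\<Sum>i=Suc \<mu>..<Suc ?k. ?g i)) + ?g (?k + 1)"
    by (simp add: algebra_simps)
  also have "(\<Sum>i=1..<Suc \<mu>. ?g i) + (\<Sum>i=Suc \<mu>..<Suc ?k. ?g i) = (\<Sum>i=1..<Suc ?k. ?g i)"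
    by (rule sum.atLeastLessThan_concat) auto
  also have "\<dots> + ?g (?k + 1) = (\<Sum>i=1..?k + 1. ?g i)"
    by (simp add: atLeastLessThanSuc_atLeastAtMost)
  finally show ?thesis .
qed

section \<open>From the given pencils to the abstract setting\<close>

lemma coords_of_one_mu1: "mu1_coords x (Suc \<mu> + t) \<mu> 1 b \<longleftrightarrow> coords_of_one x (Suc \<mu>) t b"
proof -
  have "{\<mu>+1..Suc \<mu> + t} = {Suc \<mu>..<Suc (Suc \<mu> + t)}" "\<mu> + 1 = Suc \<mu>"
    "Suc \<mu> + t + 1 = Suc (Suc \<mu> + t)" by auto
  then show ?thesis
    unfolding mu1_coords_def coords_of_one_def nub_def nu_def
    by (simp only: sum_reversed_block_index[of "\<lambda>i _. Polynomial.smult (b i)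
        (nprod x (Suc \<mu>) (Suc (Suc \<mu> + t)) div (gam x (i+1) * gam x i))"])
qed

lemma coords_of_one_mu2: "mu2_coords x \<mu> 1 a \<longleftrightarrow> coords_of_one x 1 \<mu> a"
proof -
  have "{1..\<mu>+1} = {1..<Suc (1 + \<mu>)}" "\<mu> + 2 = Suc (1 + \<mu>)" by auto
  then show ?thesis
    unfolding mu2_coords_def coords_of_one_def nub_def nu_def
    by (simp only: sum_reversed_block_index[of "\<lambda>i _. Polynomial.smult (a i)
        (nprod x 1 (Suc (1 + \<mu>)) div (gam x (i+1) * gam x i))"])
qed

lemma K1_Lagr_eq: "K1_Lagr x (Suc \<mu> + t) \<mu> n = bidiag x (Suc \<mu>) t n"
  and K2_Lagr_eq: "K2_Lagr x \<mu> m = bidiag x 1 \<mu> m"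
  by (simp_all add: K1_Lagr_def K2_Lagr_def)

lemma const_poly_mat_carrier: "A \<in> carrier_mat d e \<Longrightarrow> const_poly_mat A \<in> carrier_mat d e"
  by (simp add: const_poly_mat_def)

text \<open>Transposition exchanges \<open>K1\<close> with \<open>K2\<close> and \<open>A\<close>
  with the transpose of \<open>B\<close>; the summands are reordered to have the shape of the
  original pencil again.\<close>

lemma transpose_bordered:
  fixes M A B K1 K2 :: poly_mat
  assumes M: "M \<in> carrier_mat p q" and A: "A \<in> carrier_mat p r" and B: "B \<in> carrier_mat s q"
    and K1: "K1 \<in> carrier_mat r q" and K2: "K2 \<in> carrier_mat s p"
  shows "(four_block_mat (M + A * K1 + K2\<^sup>T * B) K2\<^sup>T K1 (0\<^sub>m r s))\<^sup>T =
    four_block_mat (M\<^sup>T + B\<^sup>T * K2 + K1\<^sup>T * A\<^sup>T) K1\<^sup>T K2 (0\<^sub>m s r)"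
proof -
  have AK: "A * K1 \<in> carrier_mat p q" and KB: "K2\<^sup>T * B \<in> carrier_mat p q" and K2T: "K2\<^sup>T \<in> carrier_mat p s"
    using assms by auto
  have "(M + A * K1 + K2\<^sup>T * B)\<^sup>T = M\<^sup>T + K1\<^sup>T * A\<^sup>T + B\<^sup>T * K2"
    using transpose_add[OF add_carrier_mat[OF AK] KB, of M] transpose_add[OF M AK]
      transpose_mult[OF A K1] transpose_mult[OF K2T B] by simp
  also have "\<dots> = M\<^sup>T + B\<^sup>T * K2 + K1\<^sup>T * A\<^sup>T"
    using assms by (intro eq_matI) (auto simp: algebra_simps)
  finally have top: "(M + A * K1 + K2\<^sup>T * B)\<^sup>T = M\<^sup>T + B\<^sup>T * K2 + K1\<^sup>T * A\<^sup>T" .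
  have "M + A * K1 + K2\<^sup>T * B \<in> carrier_mat p q"
    by (rule add_carrier_mat[OF KB])
  from transpose_four_block_mat[OF this K2T K1 zero_carrier_mat] show ?thesis
    by (simp add: top)
qed

theorem theorem4p11:
  fixes k m n \<mu> :: nat
    and x :: "nat \<Rightarrow> complex"
    and P :: "nat \<Rightarrow> complex mat"
    and Pol L :: "complex poly mat"
    and A B :: "complex mat"
    and a b :: "nat \<Rightarrow> complex"
  assumes "k \<ge> 1" and "m \<ge> 1" and "n \<ge> 1"
    and nodes: "inj_on x {1..k+1}"
    and coeffs: "\<And>i. i \<in> {1..k+1} \<Longrightarrow> P i \<in> carrier_mat m n"
    and Pol: "Pol = lagrange_poly_mat x k m n P"
    and sing: "singular_poly_mat Pol"
    and mu: "\<mu> \<le> k - 1"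
    and A: "A \<in> carrier_mat ((\<mu>+1) * m) ((k-\<mu>-1) * n)"
    and B: "B \<in> carrier_mat (\<mu> * m) ((k-\<mu>) * n)"
    and L: "L = L_Lagr x k \<mu> m n P A B"
    and a: "mu2_coords x \<mu> 1 a"
    and b: "mu1_coords x k \<mu> 1 b"
  shows
    "(\<forall>zs. right_minimal_basis L zs \<longrightarrow>
        right_minimal_basis Pol (map (\<lambda>z. right_recovery k \<mu> m n b *\<^sub>v z) zs))
     \<and> (\<forall>es. right_minimal_indices L es \<longrightarrow>
        (\<forall>e\<in>set es. 0 \<le> int e - int k + int \<mu> + 1) \<and>
        right_minimal_indices Pol (map (\<lambda>e. nat (int e - int k + int \<mu> + 1)) es))
     \<and> (\<forall>ws. left_minimal_basis L ws \<longrightarrow>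
        left_minimal_basis Pol (map (\<lambda>w. left_recovery k \<mu> m n a *\<^sub>v w) ws))
     \<and> (\<forall>es. left_minimal_indices L es \<longrightarrow>
        (\<forall>e\<in>set es. 0 \<le> int e - int \<mu>) \<and>
        left_minimal_indices Pol (map (\<lambda>e. nat (int e - int \<mu>)) es))"
proof -
  \<comment> \<open>The number of block rows of \<open>K\<^sub>1\<close> and the degree of its dual
    basis; writing \<open>k\<close> as \<open>Suc \<mu> + t\<close> removes the truncated
    subtractions.\<close>
  define t where "t = k - \<mu> - 1"
  have k: "k = Suc \<mu> + t"
    using mu \<open>k \<ge> 1\<close> by (simp add: t_def)
  have kt: "k - \<mu> - 1 = t" "k - \<mu> = Suc t"
    by (simp_all add: k)
  have P: "P i \<in> carrier_mat m n" if "i \<in> {1..Suc \<mu> + t + 1}" for i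
    using coeffs that by (simp add: k)
  let ?M = "M_Lagr x k \<mu> m n P" and ?A = "const_poly_mat A" and ?B = "const_poly_mat B"
  have M: "?M \<in> carrier_mat (Suc \<mu> * m) (Suc t * n)"
    unfolding k by (rule M_Lagr_carrier)
  have cA: "?A \<in> carrier_mat (Suc \<mu> * m) (t * n)" and cB: "?B \<in> carrier_mat (\<mu> * m) (Suc t * n)"
    using A B unfolding kt by (simp_all add: const_poly_mat_carrier)
  have cPol: "Pol \<in> carrier_mat m n"
    by (simp add: Pol lagrange_poly_mat_def)
  have degM: "degree (?M $$ (i, j)) \<le> 1" if "i < Suc \<mu> * m" "j < Suc t * n" for i j
    unfolding k using P that by (rule degree_M_Lagr)
  have degA: "degree (?A $$ (i, j)) = 0" if "i < Suc \<mu> * m" "j < t * n" for i j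
    using that A unfolding kt by (simp add: const_poly_mat_def)
  have degB: "degree (?B $$ (i, j)) = 0" if "i < \<mu> * m" "j < Suc t * n" for i j
    using that B unfolding kt by (simp add: const_poly_mat_def)
  have Pol_eq: "Pol $$ (e, c) =
      (\<Sum>r<Suc \<mu>. \<Sum>j<Suc t. nub x 1 \<mu> r * nub x (Suc \<mu>) t j * ?M $$ (r * m + e, j * n + c))"
    if "e < m" "c < n" for e c
  proof -
    have "Pol $$ (e, c) = (\<Sum>r<Suc \<mu>. \<Sum>j<Suc t. nub x 1 \<mu> r * nub x (Suc \<mu>) t j *
        M_coeff x (Suc \<mu> + t) t (\<lambda>i. P i $$ (e, c)) r j)"
      unfolding sum_nub_M_coeff using that by (simp add: Pol lagrange_poly_mat_def k)
    also have "\<dots> = (\<Sum>r<Suc \<mu>. \<Sum>j<Suc t. nub x 1 \<mu> r * nub x (Suc \<mu>) t j * ?M $$ (r * m + e, j * n + c))"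
    proof (intro sum.cong refl arg_cong2[where f = "(*)"])
      fix r j assume "r \<in> {..<Suc \<mu>}" "j \<in> {..<Suc t}"
      then show "M_coeff x (Suc \<mu> + t) t (\<lambda>i. P i $$ (e, c)) r j = ?M $$ (r * m + e, j * n + c)"
        unfolding k using M_Lagr_index[where P = P and m = m and n = n] P that by simp
    qed
    finally show ?thesis .
  qed
  have L_eq: "L = four_block_mat (?M + ?A * bidiag x (Suc \<mu>) t n + (bidiag x 1 \<mu> m)\<^sup>T * ?B)
      (bidiag x 1 \<mu> m)\<^sup>T (bidiag x (Suc \<mu>) t n) (0\<^sub>m (t * n) (\<mu> * m))"
    unfolding L L_Lagr_def kt(1) K2_Lagr_eq unfolding k K1_Lagr_eq ..
  interpret right: block_minimal_bases_pencil x "Suc \<mu>" t 1 \<mu> m n ?M ?A ?B Pol b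
  proof
    show "inj_on x {1..Suc (1 + \<mu>)}"
      using nodes by (rule inj_on_subset) (auto simp: k)
    show "coords_of_one x (Suc \<mu>) t b"
      using b unfolding k coords_of_one_mu1 .
  qed (use \<open>n \<ge> 1\<close> M cA cB cPol degM degB Pol_eq in auto)
  \<comment> \<open>The two families and block sizes change places, and \<open>?A\<^sup>T\<close>
    now acts as the constant matrix next to the transposed pencil, so that the degree shift is
    \<open>\<mu>\<close>.\<close>
  interpret left: block_minimal_bases_pencil x 1 \<mu> "Suc \<mu>" t n m "?M\<^sup>T" "?B\<^sup>T" "?A\<^sup>T" "Pol\<^sup>T" a
  proof
    show "inj_on x {Suc \<mu>..Suc (Suc \<mu> + t)}"
      using nodes by (rule inj_on_subset) (auto simp: k)
    show "coords_of_one x 1 \<mu> a"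
      using a unfolding coords_of_one_mu2 .
    show "Pol\<^sup>T $$ (e, c) = (\<Sum>r<Suc t. \<Sum>j<Suc \<mu>. nub x (Suc \<mu>) t r * nub x 1 \<mu> j * ?M\<^sup>T $$ (r * n + e, j * m + c))"
      if ec: "e < n" "c < m" for e c
    proof -
      have "Pol\<^sup>T $$ (e, c) = (\<Sum>r<Suc t. \<Sum>j<Suc \<mu>. nub x 1 \<mu> j * nub x (Suc \<mu>) t r * ?M $$ (j * m + c, r * n + e))"
        using ec cPol by (simp only: index_transpose_mat carrier_matD Pol_eq) (rule sum.swap)
      also have "\<dots> = (\<Sum>r<Suc t. \<Sum>j<Suc \<mu>. nub x (Suc \<mu>) t r * nub x 1 \<mu> j * ?M\<^sup>T $$ (r * n + e, j * m + c))"
      proof (intro sum.cong refl)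
        fix r j assume "r \<in> {..<Suc t}" "j \<in> {..<Suc \<mu>}"
        then have "?M\<^sup>T $$ (r * n + e, j * m + c) = ?M $$ (j * m + c, r * n + e)"
          using M ec block_index_less[of r "Suc t" e n] block_index_less[of j "Suc \<mu>" c m]
          by (intro index_transpose_mat) auto
        then show "nub x 1 \<mu> j * nub x (Suc \<mu>) t r * ?M $$ (j * m + c, r * n + e) =
            nub x (Suc \<mu>) t r * nub x 1 \<mu> j * ?M\<^sup>T $$ (r * n + e, j * m + c)"
          by simp
      qed
      finally show ?thesis .
    qed
    show "degree (?M\<^sup>T $$ (i, j)) \<le> 1" if "i < Suc t * n" "j < Suc \<mu> * m" for i j
      using degM[OF that(2,1)] M that by simp
    show "degree (?A\<^sup>T $$ (i, j)) = 0" if "i < t * n" "j < Suc \<mu> * m" for i j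
      using degA[OF that(2,1)] cA that by simp
  qed (use \<open>m \<ge> 1\<close> M cA cB cPol in auto)
  have R_eq: "right_recovery k \<mu> m n b = right.R"
    by (simp add: right_recovery_def k)
  have R'_eq: "left_recovery k \<mu> m n a = left.R"
    by (simp add: left_recovery_def k)
  have right_L: "right.L = L"
    unfolding right.L_def L_eq ..
  have left_L: "left.L = L\<^sup>T"
    unfolding left.L_def L_eq
    by (rule transpose_bordered[OF M cA cB bidiag_pencil_carrier bidiag_pencil_carrier, symmetric])
  interpret r: nullspace_recovery L Pol "right_recovery k \<mu> m n b" t
    using right.nullspace_recovery unfolding right_L R_eq .
  interpret l: nullspace_recovery "L\<^sup>T" "Pol\<^sup>T" "left_recovery k \<mu> m n a" \<mu>
    using left.nullspace_recovery unfolding left_L R'_eq .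
  \<comment> \<open>The integer expressions of the statement subtract \<open>t\<close> and
    \<open>\<mu>\<close>; \<open>nat\<close> truncates just as subtraction on natural numbers
    does.\<close>
  have shift: "(\<lambda>e. nat (int e - int k + int \<mu> + 1)) = (\<lambda>e. e - t)" "(\<lambda>e. nat (int e - int \<mu>)) = (\<lambda>e. e - \<mu>)"
    by (auto simp: k)
  have nonneg: "0 \<le> int e - int k + int \<mu> + 1 \<longleftrightarrow> t \<le> e" "0 \<le> int e - int \<mu> \<longleftrightarrow> \<mu> \<le> e" for e
    by (auto simp: k)
  show ?thesis
    unfolding left_minimal_basis_eq left_minimal_indices_eq shift nonneg
    using r.right_minimal_basis_recovery r.right_minimal_indices_recovery
      l.right_minimal_basis_recovery l.right_minimal_indices_recovery
    by blast
qed

end
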